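(* Consider a strong phase-access theory on arbitrary unknown inputs: for every finite $d$ it supplies on $\mathbb{C}^d$ a phase convention $\Gamma$ and a superposition primitive $\mathsf{S}_{\alpha,\beta}$ for some complex $\alpha,\beta$ with $\alpha\beta\neq 0$, in addition to all ordinary quantum preparations, operations and measurements. Then: (i) (Cloning.) There is a finite linearly dependent set of pure states that can be probabilistically cloned in this theory: there are a finite-dimensional Hilbert space $\mathbb{C}^d$, pairwise distinct rays $P_1,\dots,P_m$ in $\mathbb{C}^d$ whose representing vectors $\psi_1,\dots,\psi_m$ are linearly dependent, and a protocol composed of one use of $\mathsf{S}_{\alpha,\beta}$ and ordinary quantum operations which, on one copy of an input promised to be some $P_j$, outputs either "failure" or a conclusive result, such that for every $j$ the conclusive result occurs with strictly positive probability and, whenever it occurs, the output is exactly $\psi_j\otimes\psi_j$. (ii) (Signaling.) The resulting discrimination/cloning primitive can be combined with steering to transmit information without classical communication: there are a bipartite pure state shared by Alice and Bob, two local measurements (indexed by a bit $b$) on Alice's system, and a local procedure of Bob composed of the primitive $\mathsf{S}_{\alpha,\beta}$ and ordinary quantum operations and ending with a classical outcome, such that the probability distribution of Bob's outcome (averaged over Alice's unreported outcomes) is different for $b=0$ and $b=1$. (iii) (Search.) If, moreover, strong phase access supplies at unit cost the reflection $R_\psi=2|\psi\rangle\langle\psi|-\mathbb{1}$ about the current unknown state $|\psi\rangle$ of the computation, then unstructured search with a unique marked item can be solved using $O(\log N)$ oracle queries: there are absolute constants $C,c>0$ such that for every $N=2^n$, $n\ge 1$, there is a procedure which, for every unknown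 marked item $w\in\{0,\dots,N-1\}$, starts from a $w$-independent state in $\mathbb{C}^N$, uses at most $C\log N$ calls to the phase oracle $O_f$ together with reflections about the current state, and ends with a computational-basis measurement returning $w$ with probability at least $c$.
   Context: A ray is a rank-one orthogonal projector $P=|\psi\rangle\langle\psi|$ with $\|\psi\|=1$ on a finite-dimensional complex Hilbert space. A phase convention $\Gamma$ on a set of rays is a map assigning to each ray $P$ a unit vector $|\psi_\Gamma\rangle$ with $P=|\psi_\Gamma\rangle\langle\psi_\Gamma|$. Superposition primitive: $\mathsf{S}_{\alpha,\beta}$ takes as input one copy each of two unknown pure states, given as rays $P_\psi,P_\phi$ on $\mathbb{C}^d$ with $\alpha|\psi_\Gamma\rangle+\beta|\phi_\Gamma\rangle\neq 0$. It succeeds with some strictly positive probability (possibly depending on the inputs), success being heralded, and upon success it outputs the pure state $$\frac{\alpha|\psi_\Gamma\rangle+\beta|\phi_\Gamma\rangle}{\|\alpha|\psi_\Gamma\rangle+\beta|\phi_\Gamma\rangle\|}.$$ It is not assumed to be a linear or completely positive map. When the input is drawn at random from an ensemble of pure states, probabilities are obtained by averaging the probabilities for the individual pure states in the ensemble. Steering: when Alice measures her part of a shared pure state $|\Omega\rangle_{AB}$, Bob's system is prepared, with the corresponding outcome probability, in the corresponding conditional state; Bob's statistics are the averages over the resulting ensemble. If each of Alice's measurements has rank-one elements, these conditional states are pure. Search: the oracle for marked item $w$ is the unitary $O_f|x\rangle=(-1)^{f(x)}|x\rangle$ on $\mathbb{C}^N$ with computational basis $\{|x\rangle\}_{x=0}^{N-1}$,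 where $f(w)=1$ and $f(x)=0$ for $x\ne w$. "Reflections about the current state" means that in each round, if the state at the beginning of the round is $|\psi_r\rangle$ (which may depend on $w$), the unitary $R_{\psi_r}=2|\psi_r\rangle\langle\psi_r|-\mathbb{1}$ may be applied during that round, without oracle cost. *)

theory Defs
  imports "Jordan_Normal_Form.Schur_Decomposition"
begin

section \<open>Pure states, rays and tensor products\<close>

definition vnorm :: "complex vec \<Rightarrow> real" where
  "vnorm v = sqrt (Re (v \<bullet>c v))"

definition unit_state :: "nat \<Rightarrow> complex vec \<Rightarrow> bool" where
  "unit_state d v \<longleftrightarrow> v \<in> carrier_vec d \<and> vnorm v = 1"

definition normalize_vec :: "complex vec \<Rightarrow> complex vec" where
  "normalize_vec v = complex_of_real (1 / vnorm v) \<cdot>\<^sub>v v"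

definition ket_bra :: "complex vec \<Rightarrow> complex mat" where
  "ket_bra v = mat (dim_vec v) (dim_vec v) (\<lambda>(i, j). v $ i * cnj (v $ j))"

definition ray :: "nat \<Rightarrow> complex mat \<Rightarrow> bool" where
  "ray d P \<longleftrightarrow> (\<exists>v. unit_state d v \<and> P = ket_bra v)"

text \<open>The basis vector \<open>|i\<rangle> \<otimes> |j\<rangle>\<close> of \<open>\<complex>\<^sup>m \<otimes> \<complex>\<^sup>n\<close> is the basis vector with
  index \<open>i * n + j\<close> of \<open>\<complex>\<close> to the power \<open>m * n\<close>.\<close>

definition tensor_vec :: "complex vec \<Rightarrow> complex vec \<Rightarrow> complex vec" where
  "tensor_vec u v =
    vec (dim_vec u * dim_vec v) (\<lambda>i. u $ (i div dim_vec v) * v $ (i mod dim_vec v))"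

definition tensor_mat :: "complex mat \<Rightarrow> complex mat \<Rightarrow> complex mat" where
  "tensor_mat A B =
    mat (dim_row A * dim_row B) (dim_col A * dim_col B)
      (\<lambda>(i, j). A $$ (i div dim_row B, j div dim_col B) * B $$ (i mod dim_row B, j mod dim_col B))"

definition mat_trace :: "complex mat \<Rightarrow> complex" where
  "mat_trace A = (\<Sum>i<dim_row A. A $$ (i, i))"

section \<open>Strong phase access\<close>

definition phase_convention :: "nat \<Rightarrow> (complex mat \<Rightarrow> complex vec) \<Rightarrow> bool" where
  "phase_convention d \<Gamma> \<longleftrightarrow> (\<forall>P. ray d P \<longrightarrow> unit_state d (\<Gamma> P) \<and> P = ket_bra (\<Gamma> P))"

text \<open>A theory provides, for each dimension \<open>d\<close>, a phase convention, two coefficients, and a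
  superposition device, described by its success probability and by the ray it outputs upon success,
  both as functions of the two input rays.\<close>

record phase_theory =
  convention :: "nat \<Rightarrow> complex mat \<Rightarrow> complex vec"
  alpha :: "nat \<Rightarrow> complex"
  beta :: "nat \<Rightarrow> complex"
  success_prob :: "nat \<Rightarrow> complex mat \<Rightarrow> complex mat \<Rightarrow> real"
  success_state :: "nat \<Rightarrow> complex mat \<Rightarrow> complex mat \<Rightarrow> complex mat"

definition superposition :: "phase_theory \<Rightarrow> nat \<Rightarrow> complex mat \<Rightarrow> complex mat \<Rightarrow> complex vec" where
  "superposition T d P Q =
    alpha T d \<cdot>\<^sub>v convention T d P + beta T d \<cdot>\<^sub>v convention T d Q"

text \<open>The device is unconstrained on inputs whose superposition vanishes.\<close>

definition strong_phase_access :: "phase_theory \<Rightarrow> bool" where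
  "strong_phase_access T \<longleftrightarrow>
    (\<forall>d>0. phase_convention d (convention T d) \<and> alpha T d * beta T d \<noteq> 0 \<and>
      (\<forall>P Q. ray d P \<longrightarrow> ray d Q \<longrightarrow> superposition T d P Q \<noteq> 0\<^sub>v d \<longrightarrow>
        0 < success_prob T d P Q \<and> success_prob T d P Q \<le> 1 \<and>
        success_state T d P Q = ket_bra (normalize_vec (superposition T d P Q))))"

section \<open>Protocols\<close>

text \<open>Ordinary operations are measurements with a Kraus operator for each outcome. They
  include preparations of ancillas, unitaries and (by ignoring outcomes) arbitrary quantum channels,
  and they map a pure state to an explicit ensemble of pure states, which is what the superposition
  device needs, as it need not act linearly on density matrices.\<close>

definition branch_prob :: "complex mat \<Rightarrow> complex mat \<Rightarrow> real" where
  "branch_prob K P = Re (mat_trace (K * P * mat_adjoint K))"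

definition branch_state :: "complex mat \<Rightarrow> complex mat \<Rightarrow> complex mat" where
  "branch_state K P = complex_of_real (1 / branch_prob K P) \<cdot>\<^sub>m (K * P * mat_adjoint K)"

definition complete_kraus :: "nat \<Rightarrow> complex mat list \<Rightarrow> bool" where
  "complete_kraus D Ks \<longleftrightarrow> (\<forall>K\<in>set Ks. dim_col K = D) \<and>
    foldr (+) (map (\<lambda>K. mat_adjoint K * K) Ks) (0\<^sub>m D D) = 1\<^sub>m D"

text \<open>\<open>Return r\<close> stops with classical result \<open>r\<close> and outputs the current state. \<open>Operation\<close>
  lists the Kraus operators of an ordinary operation, each with the protocol that follows its outcome.
  \<open>Superpose d k s f\<close> applies the superposition device to the first two factors of a product
  state on \<open>\<complex>\<^sup>d \<otimes> \<complex>\<^sup>d \<otimes> \<complex>\<^sup>k\<close>, and continues with \<open>s\<close> on \<open>\<complex>\<^sup>d \<otimes> \<complex>\<^sup>k\<close> upon success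
  and with \<open>f\<close> on \<open>\<complex>\<^sup>k\<close> upon failure.\<close>

datatype 'r protocol =
    Return 'r
  | Operation "(complex mat \<times> 'r protocol) list"
  | Superpose nat nat "'r protocol" "'r protocol"

fun well_formed :: "nat \<Rightarrow> 'r protocol \<Rightarrow> bool" where
  "well_formed D (Return r) \<longleftrightarrow> True"
| "well_formed D (Operation bs) \<longleftrightarrow>
    complete_kraus D (map fst bs) \<and> (\<forall>(K, q)\<in>set bs. well_formed (dim_row K) q)"
| "well_formed D (Superpose d k s f) \<longleftrightarrow>
    D = d * (d * k) \<and> well_formed (d * k) s \<and> well_formed k f"

text \<open>The largest number of uses of the superposition device in a run.\<close>

fun uses :: "'r protocol \<Rightarrow> nat" where
  "uses (Return r) = 0"
| "uses (Operation bs) = foldr max (map (\<lambda>(K, q). uses q) bs) 0"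
| "uses (Superpose d k s f) = Suc (max (uses s) (uses f))"

definition product_factors ::
  "nat \<Rightarrow> nat \<Rightarrow> complex mat \<Rightarrow> complex mat \<times> complex mat \<times> complex mat \<Rightarrow> bool" where
  "product_factors d k P = (\<lambda>(A, B, M).
    ray d A \<and> ray d B \<and> ray k M \<and> P = tensor_mat A (tensor_mat B M))"

text \<open>The factors of a product ray are unique because rays have trace one.\<close>

definition the_factors ::
  "nat \<Rightarrow> nat \<Rightarrow> complex mat \<Rightarrow> complex mat \<times> complex mat \<times> complex mat" where
  "the_factors d k P = (THE F. product_factors d k P F)"

text \<open>On the pure input \<open>P\<close>, the superposition device is used only where it is specified: on
  product inputs whose superposition does not vanish. Branches of probability zero are ignored.\<close>

fun admissible :: "phase_theory \<Rightarrow> 'r protocol \<Rightarrow> complex mat \<Rightarrow> bool" where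
  "admissible T (Return r) P \<longleftrightarrow> True"
| "admissible T (Operation bs) P \<longleftrightarrow>
    (\<forall>(K, q)\<in>set bs. branch_prob K P \<noteq> 0 \<longrightarrow> admissible T q (branch_state K P))"
| "admissible T (Superpose d k s f) P \<longleftrightarrow>
    (\<exists>F. product_factors d k P F) \<and>
    (case the_factors d k P of (A, B, M) \<Rightarrow>
      superposition T d A B \<noteq> 0\<^sub>v d \<and>
      admissible T s (tensor_mat (success_state T d A B) M) \<and>
      (success_prob T d A B \<noteq> 1 \<longrightarrow> admissible T f M))"

text \<open>The probability that the classical result and the output ray, started on the pure
  state \<open>P\<close>, form a pair in \<open>E\<close>.\<close>

fun result_prob ::
  "phase_theory \<Rightarrow> 'r protocol \<Rightarrow> complex mat \<Rightarrow> ('r \<times> complex mat) set \<Rightarrow> real" where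
  "result_prob T (Return r) P E = (if (r, P) \<in> E then 1 else 0)"
| "result_prob T (Operation bs) P E =
    (\<Sum>(K, q)\<leftarrow>bs. branch_prob K P * result_prob T q (branch_state K P) E)"
| "result_prob T (Superpose d k s f) P E =
    (case the_factors d k P of (A, B, M) \<Rightarrow>
      success_prob T d A B * result_prob T s (tensor_mat (success_state T d A B) M) E +
      (1 - success_prob T d A B) * result_prob T f M E)"

section \<open>Cloning\<close>

text \<open>The result \<open>True\<close> is the conclusive one and \<open>False\<close> is failure.\<close>

definition clones :: "phase_theory \<Rightarrow> bool protocol \<Rightarrow> complex vec \<Rightarrow> bool" where
  "clones T q v \<longleftrightarrow>
    admissible T q (ket_bra v) \<and>
    result_prob T q (ket_bra v) {(r, P). r} > 0 \<and>
    result_prob T q (ket_bra v) {(r, P). r \<and> P \<noteq> ket_bra (tensor_vec v v)} = 0"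

section \<open>Steering\<close>

text \<open>The vectors \<open>e\<close> represent the rank-one measurement elements \<open>|e\<rangle>\<langle>e|\<close>.\<close>

definition rank_one_measurement :: "nat \<Rightarrow> complex vec list \<Rightarrow> bool" where
  "rank_one_measurement d es \<longleftrightarrow>
    (\<forall>e\<in>set es. e \<in> carrier_vec d \<and> e \<noteq> 0\<^sub>v d) \<and> foldr (+) (map ket_bra es) (0\<^sub>m d d) = 1\<^sub>m d"

text \<open>The operator \<open>\<langle>e| \<otimes> \<one>\<close>, which maps the shared state to Bob's conditional state,
  where Bob's dimension is \<open>n\<close>.\<close>

definition steering_kraus :: "nat \<Rightarrow> complex vec \<Rightarrow> complex mat" where
  "steering_kraus n e = tensor_mat (mat 1 (dim_vec e) (\<lambda>(i, j). cnj (e $ j))) (1\<^sub>m n)"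

definition steered_admissible ::
  "phase_theory \<Rightarrow> nat \<Rightarrow> complex vec \<Rightarrow> complex vec list \<Rightarrow> 'r protocol \<Rightarrow> bool" where
  "steered_admissible T n \<Omega> es q \<longleftrightarrow>
    (\<forall>e\<in>set es. branch_prob (steering_kraus n e) (ket_bra \<Omega>) \<noteq> 0 \<longrightarrow>
      admissible T q (branch_state (steering_kraus n e) (ket_bra \<Omega>)))"

definition steered_distribution ::
  "phase_theory \<Rightarrow> nat \<Rightarrow> complex vec \<Rightarrow> complex vec list \<Rightarrow> 'r protocol \<Rightarrow> 'r \<Rightarrow> real" where
  "steered_distribution T n \<Omega> es q r =
    (\<Sum>e\<leftarrow>es. branch_prob (steering_kraus n e) (ket_bra \<Omega>) *
      result_prob T q (branch_state (steering_kraus n e) (ket_bra \<Omega>)) {(r', P). r' = r})"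

section \<open>Search\<close>

definition phase_oracle :: "nat \<Rightarrow> (nat \<Rightarrow> nat) \<Rightarrow> complex mat" where
  "phase_oracle N f = mat N N (\<lambda>(i, j). if i = j then (-1) ^ f i else 0)"

definition marked :: "nat \<Rightarrow> nat \<Rightarrow> nat" where
  "marked w x = (if x = w then 1 else 0)"

definition reflection_access :: "(nat \<Rightarrow> complex mat \<Rightarrow> complex mat) \<Rightarrow> bool" where
  "reflection_access R \<longleftrightarrow> (\<forall>d>0. \<forall>P. ray d P \<longrightarrow> R d P = 2 \<cdot>\<^sub>m P - 1\<^sub>m d)"

text \<open>A search procedure is a list of rounds, and a round is a list of gates. All the \<open>Reflect\<close>
  gates of a round reflect about the state at the beginning of that round.\<close>

datatype gate = Oracle | Reflect

fun apply_gate ::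
  "(nat \<Rightarrow> complex mat \<Rightarrow> complex mat) \<Rightarrow> nat \<Rightarrow> nat \<Rightarrow> complex vec \<Rightarrow> gate \<Rightarrow> complex vec \<Rightarrow> complex vec"
  where
  "apply_gate R N w v\<^sub>0 Oracle v = phase_oracle N (marked w) *\<^sub>v v"
| "apply_gate R N w v\<^sub>0 Reflect v = R N (ket_bra v\<^sub>0) *\<^sub>v v"

definition run_round ::
  "(nat \<Rightarrow> complex mat \<Rightarrow> complex mat) \<Rightarrow> nat \<Rightarrow> nat \<Rightarrow> gate list \<Rightarrow> complex vec \<Rightarrow> complex vec" where
  "run_round R N w gs v = fold (apply_gate R N w v) gs v"

definition run_search ::
  "(nat \<Rightarrow> complex mat \<Rightarrow> complex mat) \<Rightarrow> nat \<Rightarrow> nat \<Rightarrow> gate list list \<Rightarrow> complex vec \<Rightarrow> complex vec" where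
  "run_search R N w rounds v = fold (run_round R N w) rounds v"

definition oracle_calls :: "gate list list \<Rightarrow> nat" where
  "oracle_calls rounds = count_list (concat rounds) Oracle"

end

theory Submission
  imports Defs
begin

text \<open>Superposing an unknown state \<open>\<psi>\<close> of a plane with a reference state \<open>u\<close> orthogonal to it yields
  a multiple of \<open>\<alpha> \<psi>\<^sub>\<Gamma> + \<beta> u\<close>, and such vectors are linearly independent whenever the \<open>\<psi>\<^sub>\<Gamma>\<close> are
  affinely independent. If \<open>\<psi>\<^sub>0\<close> and \<open>\<psi>\<^sub>1\<close> are the images under the convention of two orthogonal basis
  rays, no phase places \<open>(\<psi>\<^sub>0 - \<psi>\<^sub>1) / \<surd>2\<close> on the affine line through them, so the device turns three
  dependent states into independent ones, which are discriminated without error by testing for the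
  dual vectors. For signaling, Alice steers to \<open>{\<psi>\<^sub>0, \<psi>\<^sub>1}\<close> or to \<open>{(\<psi>\<^sub>0 \<plusminus> \<psi>\<^sub>1) / \<surd>2}\<close>, and Bob tests
  for the dual vector of the third state, which succeeds with probability zero only on the first ensemble.
  For search, the oracle maps the Grover angle \<open>\<theta>\<close> to \<open>-\<theta>\<close>, and reflecting about the state before the
  oracle call gives \<open>2\<theta> - (-\<theta>) = 3\<theta>\<close>: the angle grows exponentially.\<close>

section \<open>Kets, norms and tensor products\<close>

lemma mat_adjoint_dims [simp]:
  "dim_row (mat_adjoint K) = dim_col K" "dim_col (mat_adjoint K) = dim_row K"
  by (simp_all add: mat_adjoint_def)

lemma mat_adjoint_index [simp]:
  fixes K :: "complex mat"
  shows "i < dim_col K \<Longrightarrow> j < dim_row K \<Longrightarrow> mat_adjoint K $$ (i, j) = cnj (K $$ (j, i))"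
  by (simp add: mat_adjoint_def mat_of_rows_index)

lemma ket_bra_dims [simp]: "dim_row (ket_bra v) = dim_vec v" "dim_col (ket_bra v) = dim_vec v"
  by (simp_all add: ket_bra_def)

lemma ket_bra_index [simp]:
  "i < dim_vec v \<Longrightarrow> j < dim_vec v \<Longrightarrow> ket_bra v $$ (i, j) = v $ i * cnj (v $ j)"
  by (simp add: ket_bra_def)

lemma cscalar_prod_eq: "v \<bullet>c w = (\<Sum>i<dim_vec w. v $ i * cnj (w $ i))"
  by (simp add: scalar_prod_def lessThan_atLeast0)

lemma cscalar_prod_self: "v \<bullet>c v = complex_of_real ((vnorm v)\<^sup>2)"
proof -
  have "v \<bullet>c v = complex_of_real (\<Sum>i<dim_vec v. (cmod (v $ i))\<^sup>2)"
    by (simp add: cscalar_prod_eq complex_norm_square del: of_real_power)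
  then show ?thesis
    by (simp add: vnorm_def sum_nonneg del: of_real_sum)
qed

lemma vnorm_square: "(vnorm v)\<^sup>2 = (\<Sum>i<dim_vec v. (cmod (v $ i))\<^sup>2)"
proof -
  have "complex_of_real ((vnorm v)\<^sup>2) = complex_of_real (\<Sum>i<dim_vec v. (cmod (v $ i))\<^sup>2)"
    unfolding cscalar_prod_self[symmetric] by (simp add: cscalar_prod_eq complex_norm_square del: of_real_power)
  then show ?thesis using of_real_eq_iff by blast
qed

lemma vnorm_nonneg [simp]: "0 \<le> vnorm v"
proof -
  have "Re (v \<bullet>c v) \<ge> 0" by (simp add: cscalar_prod_self)
  then show ?thesis by (simp add: vnorm_def)
qed

lemma vnorm_smult: "vnorm (c \<cdot>\<^sub>v v) = cmod c * vnorm v"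
proof (rule power2_eq_imp_eq)
  show "(vnorm (c \<cdot>\<^sub>v v))\<^sup>2 = (cmod c * vnorm v)\<^sup>2"
    by (simp add: vnorm_square power_mult_distrib norm_mult sum_distrib_left)
qed simp_all

lemma vnorm_eq_0: "v \<in> carrier_vec d \<Longrightarrow> vnorm v = 0 \<longleftrightarrow> v = 0\<^sub>v d"
  using conjugate_square_eq_0_vec[of v d] by (simp add: cscalar_prod_self)

lemma unit_state_iff_cscalar: "unit_state d v \<longleftrightarrow> v \<in> carrier_vec d \<and> v \<bullet>c v = 1"
proof -
  have "v \<bullet>c v = 1 \<longleftrightarrow> (vnorm v)\<^sup>2 = 1"
    unfolding cscalar_prod_self of_real_eq_1_iff ..
  also have "\<dots> \<longleftrightarrow> vnorm v = 1"
    by (metis one_power2 power2_eq_imp_eq vnorm_nonneg zero_le_one)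
  finally show ?thesis unfolding unit_state_def by simp
qed

lemma unit_state_iff:
  "unit_state d v \<longleftrightarrow> dim_vec v = d \<and> (\<Sum>i<d. (cmod (v $ i))\<^sup>2) = 1"
  unfolding unit_state_iff_cscalar cscalar_prod_self vnorm_square of_real_eq_1_iff carrier_vec_def
  by auto

lemma unit_state_normalize:
  assumes "v \<in> carrier_vec d" "v \<noteq> 0\<^sub>v d"
  shows "unit_state d (normalize_vec v)"
  using assms vnorm_eq_0[OF assms(1)]
  by (simp add: unit_state_def normalize_vec_def vnorm_smult norm_divide)

lemma smult_cscalar_prod:
  fixes c :: complex
  shows "dim_vec v = dim_vec w \<Longrightarrow> (c \<cdot>\<^sub>v v) \<bullet>c w = c * (v \<bullet>c w)"
  by (simp add: cscalar_prod_eq sum_distrib_left mult.assoc)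

lemma cscalar_prod_smult:
  fixes c :: complex
  shows "dim_vec v = dim_vec w \<Longrightarrow> v \<bullet>c (c \<cdot>\<^sub>v w) = cnj c * (v \<bullet>c w)"
  by (simp add: cscalar_prod_eq sum_distrib_left mult_ac)

lemma normalize_cscalar_prod_eq_0:
  assumes "v \<in> carrier_vec d" "w \<in> carrier_vec d" "v \<noteq> 0\<^sub>v d"
  shows "normalize_vec v \<bullet>c w = 0 \<longleftrightarrow> v \<bullet>c w = 0"
  using assms vnorm_eq_0[of v d] by (auto simp: normalize_vec_def smult_cscalar_prod)

lemma cscalar_prod_normalize_eq_0:
  assumes "v \<in> carrier_vec d" "w \<in> carrier_vec d" "w \<noteq> 0\<^sub>v d"
  shows "v \<bullet>c normalize_vec w = 0 \<longleftrightarrow> v \<bullet>c w = 0"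
  using assms vnorm_eq_0[of w d] by (auto simp: normalize_vec_def cscalar_prod_smult)

section \<open>Projectors onto vectors and their phase freedom\<close>

lemma ket_bra_smult: "ket_bra (c \<cdot>\<^sub>v v) = complex_of_real ((cmod c)\<^sup>2) \<cdot>\<^sub>m ket_bra v"
  by (rule eq_matI) (auto simp: complex_norm_square simp del: of_real_power)

lemma ket_bra_phase: "cmod c = 1 \<Longrightarrow> ket_bra (c \<cdot>\<^sub>v v) = ket_bra v"
  by (simp add: ket_bra_smult) (rule eq_matI, auto)

text \<open>Normalization removes the modulus of the scalar, and the phase that remains cancels in
  the projector. Conditional states are identified this way whenever a Kraus operator yields a
  multiple of a known unit vector.\<close>

lemma ket_bra_normalize_smult:
  assumes "c \<noteq> 0" "vnorm v = 1"
  shows "ket_bra (normalize_vec (c \<cdot>\<^sub>v v)) = ket_bra v"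
proof -
  have "normalize_vec (c \<cdot>\<^sub>v v) = (complex_of_real (1 / cmod c) * c) \<cdot>\<^sub>v v"
    using assms by (simp add: normalize_vec_def vnorm_smult smult_smult_assoc)
  moreover have "cmod (complex_of_real (1 / cmod c) * c) = 1"
    using assms by (simp add: norm_mult norm_divide)
  ultimately show ?thesis by (simp only: ket_bra_phase)
qed

lemma ket_bra_mult_vec:
  "dim_vec w = dim_vec v \<Longrightarrow> ket_bra v *\<^sub>v w = (w \<bullet>c v) \<cdot>\<^sub>v v"
  by (rule eq_vecI)
    (auto simp: scalar_prod_def sum_distrib_left sum_distrib_right mult_ac intro!: sum.cong)

text \<open>Applying both projectors to \<open>u\<close> exhibits \<open>u\<close> as
  \<open>(u \<bullet>c v) \<cdot>\<^sub>v v\<close>; comparing norms forces this overlap to have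
  modulus one.\<close>

lemma ket_bra_eq_imp_phase:
  assumes "unit_state d u" "unit_state d v" "ket_bra u = ket_bra v"
  obtains r where "cmod r = 1" "u = r \<cdot>\<^sub>v v"
proof -
  have d: "dim_vec u = d" "dim_vec v = d" using assms(1,2) by (auto simp: unit_state_def)
  have "(u \<bullet>c u) \<cdot>\<^sub>v u = (u \<bullet>c v) \<cdot>\<^sub>v v"
    using assms(3) d ket_bra_mult_vec[of u u] ket_bra_mult_vec[of u v] by simp
  then have u: "u = (u \<bullet>c v) \<cdot>\<^sub>v v"
    using assms(1) by (simp add: cscalar_prod_self unit_state_def)
  moreover have "cmod (u \<bullet>c v) = 1"
    using vnorm_smult[of "u \<bullet>c v" v] u assms(1,2) by (simp add: unit_state_def)
  ultimately show thesis using that by blast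
qed

lemma mat_trace_ket_bra: "mat_trace (ket_bra v) = complex_of_real ((vnorm v)\<^sup>2)"
  unfolding cscalar_prod_self[symmetric] by (simp add: mat_trace_def cscalar_prod_eq)

lemma ray_ket_bra: "unit_state d v \<Longrightarrow> ray d (ket_bra v)"
  by (auto simp: ray_def)

lemma ray_dims: "ray d P \<Longrightarrow> P \<in> carrier_mat d d"
  by (auto simp: ray_def unit_state_def)

lemma ray_trace: "ray d P \<Longrightarrow> (\<Sum>i<d. P $$ (i, i)) = 1"
proof -
  assume "ray d P"
  then obtain v where v: "unit_state d v" "P = ket_bra v" by (auto simp: ray_def)
  then show ?thesis
    using mat_trace_ket_bra[of v] by (auto simp: unit_state_def mat_trace_def)
qed

section \<open>Kraus branches of pure states\<close>

lemma conj_ket_bra: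
  assumes "dim_col K = dim_vec v"
  shows "K * ket_bra v * mat_adjoint K = ket_bra (K *\<^sub>v v)"
proof (rule eq_matI)
  fix i j assume "i < dim_row (ket_bra (K *\<^sub>v v))" "j < dim_col (ket_bra (K *\<^sub>v v))"
  then have ij: "i < dim_row K" "j < dim_row K" by auto
  have "(K * ket_bra v * mat_adjoint K) $$ (i, j) =
    (\<Sum>l = 0..<dim_vec v. (\<Sum>k = 0..<dim_vec v. K $$ (i, k) * (v $ k * cnj (v $ l))) * cnj (K $$ (j, l)))"
    using ij assms by (simp add: scalar_prod_def)
  also have "\<dots> = (\<Sum>l = 0..<dim_vec v. (\<Sum>k = 0..<dim_vec v. K $$ (i, k) * v $ k) * cnj (K $$ (j, l) * v $ l))"
    by (rule sum.cong) (simp_all add: sum_distrib_left sum_distrib_right mult_ac)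
  also have "\<dots> = ket_bra (K *\<^sub>v v) $$ (i, j)"
    using ij assms by (simp add: scalar_prod_def sum_distrib_left)
  finally show "(K * ket_bra v * mat_adjoint K) $$ (i, j) = ket_bra (K *\<^sub>v v) $$ (i, j)" .
qed simp_all

lemma branch_prob_ket_bra:
  "dim_col K = dim_vec v \<Longrightarrow> branch_prob K (ket_bra v) = (vnorm (K *\<^sub>v v))\<^sup>2"
  by (simp add: branch_prob_def conj_ket_bra mat_trace_ket_bra)

lemma branch_state_ket_bra:
  "dim_col K = dim_vec v \<Longrightarrow> branch_state K (ket_bra v) = ket_bra (normalize_vec (K *\<^sub>v v))"
  by (simp add: branch_state_def branch_prob_ket_bra conj_ket_bra normalize_vec_def
      ket_bra_smult norm_divide power_divide)

section \<open>Tensor products and uniqueness of factors\<close>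

lemma index_lt_mult: "a < m \<Longrightarrow> b < n \<Longrightarrow> a * n + b < m * (n::nat)"
proof -
  assume "a < m" "b < n"
  then have "a * n + b < Suc a * n" by simp
  also have "\<dots> \<le> m * n" using \<open>a < m\<close> by (intro mult_le_mono1) simp
  finally show ?thesis .
qed

lemma mod_lt_of_lt_mult: "i < m * n \<Longrightarrow> i mod n < (n::nat)"
  by (metis gr0I mod_less_divisor mult_0_right not_less0)

text \<open>Division with remainder is the bijection between basis indices of a tensor product and
  pairs of factor indices; norms, traces and contractions all factor through it.\<close>

lemma sum_div_mod:
  fixes g :: "nat \<Rightarrow> nat \<Rightarrow> 'a::comm_monoid_add"
  shows "(\<Sum>i<m * n. g (i div n) (i mod n)) = (\<Sum>a<m. \<Sum>b<n. g a b)"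
proof -
  have "(\<Sum>i<m * n. g (i div n) (i mod n)) = (\<Sum>(a, b)\<in>{..<m} \<times> {..<n}. g a b)"
    by (rule sum.reindex_bij_witness[where i = "\<lambda>(a, b). a * n + b" and j = "\<lambda>i. (i div n, i mod n)"])
      (auto simp: index_lt_mult less_mult_imp_div_less mod_lt_of_lt_mult)
  then show ?thesis by (simp add: sum.cartesian_product)
qed

lemma unit_state_tensor:
  assumes "unit_state m u" "unit_state n v"
  shows "unit_state (m * n) (tensor_vec u v)"
proof -
  have "(\<Sum>i<m * n. (cmod (u $ (i div n) * v $ (i mod n)))\<^sup>2) =
      (\<Sum>a<m. (cmod (u $ a))\<^sup>2) * (\<Sum>b<n. (cmod (v $ b))\<^sup>2)"
    using sum_div_mod[of "\<lambda>a b. (cmod (u $ a * v $ b))\<^sup>2" n m]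
    by (simp add: norm_mult power_mult_distrib sum_product)
  then show ?thesis using assms by (simp add: unit_state_iff tensor_vec_def)
qed

lemma tensor_ket_bra: "tensor_mat (ket_bra u) (ket_bra v) = ket_bra (tensor_vec u v)"
  by (rule eq_matI)
    (auto simp: tensor_mat_def tensor_vec_def less_mult_imp_div_less mod_lt_of_lt_mult)

text \<open>The factors are recovered as partial traces.\<close>

lemma tensor_mat_inject:
  assumes "A \<in> carrier_mat m m" "A' \<in> carrier_mat m m" "N \<in> carrier_mat n n" "N' \<in> carrier_mat n n"
    and "(\<Sum>i<m. A $$ (i, i)) = 1" "(\<Sum>i<m. A' $$ (i, i)) = 1"
    and "(\<Sum>i<n. N $$ (i, i)) = 1" "(\<Sum>i<n. N' $$ (i, i)) = 1"
    and eq: "tensor_mat A N = tensor_mat A' N'"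
  shows "A = A'" "N = N'"
proof -
  have prod: "A $$ (i, j) * N $$ (a, b) = A' $$ (i, j) * N' $$ (a, b)"
    if "i < m" "j < m" "a < n" "b < n" for i j a b
  proof -
    have "tensor_mat A N $$ (i * n + a, j * n + b) = tensor_mat A' N' $$ (i * n + a, j * n + b)"
      by (simp add: eq)
    then show ?thesis
      using assms(1-4) that by (simp add: tensor_mat_def index_lt_mult)
  qed
  show "A = A'"
  proof (rule eq_matI)
    fix i j assume "i < dim_row A'" "j < dim_col A'"
    then have ij: "i < m" "j < m" using assms by auto
    have "A $$ (i, j) * (\<Sum>a<n. N $$ (a, a)) = A' $$ (i, j) * (\<Sum>a<n. N' $$ (a, a))"
      unfolding sum_distrib_left by (rule sum.cong) (auto intro: prod ij)
    then show "A $$ (i, j) = A' $$ (i, j)" using assms by simp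
  qed (use assms in auto)
  show "N = N'"
  proof (rule eq_matI)
    fix a b assume "a < dim_row N'" "b < dim_col N'"
    then have ab: "a < n" "b < n" using assms by auto
    have "(\<Sum>i<m. A $$ (i, i)) * N $$ (a, b) = (\<Sum>i<m. A' $$ (i, i)) * N' $$ (a, b)"
      unfolding sum_distrib_right by (rule sum.cong) (auto intro: prod ab)
    then show "N $$ (a, b) = N' $$ (a, b)" using assms by simp
  qed (use assms in auto)
qed

lemma tensor_mat_carrier:
  "A \<in> carrier_mat m m \<Longrightarrow> N \<in> carrier_mat n n \<Longrightarrow> tensor_mat A N \<in> carrier_mat (m * n) (m * n)"
  by (auto simp: tensor_mat_def)

lemma trace_tensor_mat:
  assumes "A \<in> carrier_mat m m" "N \<in> carrier_mat n n"
  shows "(\<Sum>i<m * n. tensor_mat A N $$ (i, i)) = (\<Sum>i<m. A $$ (i, i)) * (\<Sum>i<n. N $$ (i, i))"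
proof -
  have "(\<Sum>i<m * n. tensor_mat A N $$ (i, i)) =
      (\<Sum>i<m * n. A $$ (i div n, i div n) * N $$ (i mod n, i mod n))"
    using assms by (intro sum.cong) (auto simp: tensor_mat_def)
  also have "\<dots> = (\<Sum>a<m. \<Sum>b<n. A $$ (a, a) * N $$ (b, b))"
    by (rule sum_div_mod)
  finally show ?thesis by (simp add: sum_product)
qed

text \<open>Uniqueness for two factors is applied twice, first splitting \<open>d\<close> from
  \<open>d * k\<close>, then \<open>d\<close> from \<open>k\<close>. The first split needs the inner
  tensor product to have trace one, which holds since the trace is multiplicative. The definite
  description in \<open>the_factors\<close> can then be evaluated.\<close>

lemma the_factors_eq:
  assumes "ray d A" "ray d B" "ray k M"
  shows "product_factors d k (tensor_mat A (tensor_mat B M)) (A, B, M)"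
    and "the_factors d k (tensor_mat A (tensor_mat B M)) = (A, B, M)"
proof -
  show 1: "product_factors d k (tensor_mat A (tensor_mat B M)) (A, B, M)"
    using assms by (simp add: product_factors_def)
  show "the_factors d k (tensor_mat A (tensor_mat B M)) = (A, B, M)"
    unfolding the_factors_def
  proof (rule the_equality, rule 1)
    fix F assume F: "product_factors d k (tensor_mat A (tensor_mat B M)) F"
    obtain A' B' M' where [simp]: "F = (A', B', M')" by (cases F)
    have r: "ray d A'" "ray d B'" "ray k M'"
      and eq: "tensor_mat A (tensor_mat B M) = tensor_mat A' (tensor_mat B' M')"
      using F by (simp_all add: product_factors_def)
    note rays = assms r
    note facts = rays[THEN ray_dims] rays[THEN ray_trace]
    have BM: "A = A'" "tensor_mat B M = tensor_mat B' M'"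
      by (rule tensor_mat_inject[OF _ _ _ _ _ _ _ _ eq, of d "d * k"];
          simp add: facts tensor_mat_carrier trace_tensor_mat[of _ d _ k])+
    have "B = B'" "M = M'"
      by (rule tensor_mat_inject[OF _ _ _ _ _ _ _ _ BM(2), of d k]; simp add: facts)+
    then show "F = (A, B, M)" using BM by simp
  qed
qed

section \<open>Elementary protocols\<close>

text \<open>This is the operator \<open>1 \<otimes> |w>\<close>, which attaches an ancilla in state
  \<open>w\<close>. It is an isometry when \<open>w\<close> is a unit vector, so it is a complete
  operation on its own.\<close>

definition append_ket :: "nat \<Rightarrow> complex vec \<Rightarrow> complex mat" where
  "append_ket d w =
    mat (d * dim_vec w) d (\<lambda>(i, j). if i div dim_vec w = j then w $ (i mod dim_vec w) else 0)"

lemma append_ket_dims [simp]: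
  "dim_row (append_ket d w) = d * dim_vec w" "dim_col (append_ket d w) = d"
  by (simp_all add: append_ket_def)

lemma append_ket_mult_vec: "dim_vec v = d \<Longrightarrow> append_ket d w *\<^sub>v v = tensor_vec v w"
  by (rule eq_vecI)
    (auto simp: append_ket_def tensor_vec_def scalar_prod_def less_mult_imp_div_less
      if_distrib[of "\<lambda>x. x * _"] sum.delta cong: if_cong)

lemma complete_kraus_append_ket:
  assumes "vnorm w = 1"
  shows "complete_kraus d [append_ket d w]"
proof -
  define n where "n = dim_vec w"
  have "mat_adjoint (append_ket d w) * append_ket d w = 1\<^sub>m d"
  proof (rule eq_matI)
    fix i j assume "i < dim_row (1\<^sub>m d :: complex mat)" "j < dim_col (1\<^sub>m d :: complex mat)"
    then have ij: "i < d" "j < d" by auto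
    have "(mat_adjoint (append_ket d w) * append_ket d w) $$ (i, j) =
      (\<Sum>k<d * n. (if k div n = i then cnj (w $ (k mod n)) else 0) *
        (if k div n = j then w $ (k mod n) else 0))"
      using ij by (auto simp: scalar_prod_def lessThan_atLeast0 append_ket_def n_def intro!: sum.cong)
    also have "\<dots> = (\<Sum>a<d. \<Sum>b<n. (if a = i then cnj (w $ b) else 0) *
        (if a = j then w $ b else 0))"
      by (rule sum_div_mod)
    also have "\<dots> = (\<Sum>a<d. if a = i then (\<Sum>b<n. cnj (w $ b) * (if i = j then w $ b else 0)) else 0)"
      by (intro sum.cong) auto
    also have "\<dots> = (if i = j then w \<bullet>c w else 0)"
      using ij by (simp add: sum.delta cscalar_prod_eq n_def mult.commute)
    also have "\<dots> = 1\<^sub>m d $$ (i, j)"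
      using ij assms by (simp add: cscalar_prod_self)
    finally show "(mat_adjoint (append_ket d w) * append_ket d w) $$ (i, j) = 1\<^sub>m d $$ (i, j)" .
  qed simp_all
  then show ?thesis by (simp add: complete_kraus_def)
qed

text \<open>The unique state up to phase of a one-dimensional spectator: it fills the third factor
  that \<open>Superpose\<close> expects when nothing else is present.\<close>

definition scalar_ket :: "complex vec" where
  "scalar_ket = vec 1 (\<lambda>_. 1)"

lemma unit_scalar_ket: "unit_state 1 scalar_ket"
  by (simp add: unit_state_iff scalar_ket_def)

lemma tensor_scalar_ket: "tensor_vec v scalar_ket = v"
  by (rule eq_vecI) (simp_all add: tensor_vec_def scalar_ket_def)

lemma the_factors_ket_bra:
  assumes "unit_state d v" "unit_state d u"
  shows "product_factors d 1 (ket_bra (tensor_vec v u)) (ket_bra v, ket_bra u, ket_bra scalar_ket)"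
    and "the_factors d 1 (ket_bra (tensor_vec v u)) = (ket_bra v, ket_bra u, ket_bra scalar_ket)"
  using the_factors_eq[of d "ket_bra v" "ket_bra u" 1 "ket_bra scalar_ket"] assms
  by (simp_all only: ray_ket_bra unit_scalar_ket tensor_ket_bra tensor_scalar_ket)

section \<open>Using the device with a fixed reference state\<close>

definition superpose_with :: "nat \<Rightarrow> complex vec \<Rightarrow> 'r protocol \<Rightarrow> 'r \<Rightarrow> 'r protocol" where
  "superpose_with d u q r = Operation [(append_ket d u, Superpose d 1 q (Return r))]"

lemma well_formed_superpose_with:
  "unit_state d u \<Longrightarrow> well_formed d q \<Longrightarrow> well_formed d (superpose_with d u q r)"
  by (auto simp: superpose_with_def unit_state_def complete_kraus_append_ket)

lemma uses_superpose_with: "uses (superpose_with d u q r) = Suc (uses q)"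
  by (simp add: superpose_with_def)

lemma branch_append_ket:
  assumes "unit_state d v" "unit_state d u"
  shows "branch_prob (append_ket d u) (ket_bra v) = 1"
    and "branch_state (append_ket d u) (ket_bra v) = ket_bra (tensor_vec v u)"
proof -
  have "vnorm (tensor_vec v u) = 1" "dim_vec v = d"
    using unit_state_tensor[OF assms] assms by (auto simp: unit_state_def)
  then show "branch_prob (append_ket d u) (ket_bra v) = 1"
    and "branch_state (append_ket d u) (ket_bra v) = ket_bra (tensor_vec v u)"
    by (simp_all add: branch_prob_ket_bra branch_state_ket_bra append_ket_mult_vec normalize_vec_def)
qed

text \<open>One use of the device replaces the unknown \<open>v\<close> by the normalized
  superposition with \<open>u\<close>. The condition on \<open>E\<close> discards the failure
  branch, so only a strictly positive factor \<open>p\<close> remains, and questions whether a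
  probability vanishes pass to \<open>q\<close>.\<close>

lemma superpose_with_ket_bra:
  fixes T d u v
  assumes "strong_phase_access T" "d > 0" "unit_state d v" "unit_state d u"
    and "superposition T d (ket_bra v) (ket_bra u) \<noteq> 0\<^sub>v d"
  defines "s \<equiv> normalize_vec (superposition T d (ket_bra v) (ket_bra u))"
    and "p \<equiv> success_prob T d (ket_bra v) (ket_bra u)"
  shows "0 < p"
    and "admissible T (superpose_with d u q r) (ket_bra v) \<longleftrightarrow> admissible T q (ket_bra s)"
    and "(\<And>P. (r, P) \<notin> E) \<Longrightarrow>
      result_prob T (superpose_with d u q r) (ket_bra v) E = p * result_prob T q (ket_bra s) E"
proof -
  have "0 < p" and s: "success_state T d (ket_bra v) (ket_bra u) = ket_bra s"
    using assms by (auto simp: strong_phase_access_def ray_ket_bra)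
  then show "0 < p" by simp
  note facts = superpose_with_def branch_append_ket[OF assms(3,4)]
    the_factors_ket_bra(2)[OF assms(3,4)] s tensor_ket_bra tensor_scalar_ket assms(5)
  show "admissible T (superpose_with d u q r) (ket_bra v) \<longleftrightarrow> admissible T q (ket_bra s)"
    using the_factors_ket_bra(1)[OF assms(3,4)] by (auto simp: facts simp del: One_nat_def)
  show "result_prob T (superpose_with d u q r) (ket_bra v) E = p * result_prob T q (ket_bra s) E"
    if "\<And>P. (r, P) \<notin> E"
    using that by (simp add: facts p_def del: One_nat_def)
qed

section \<open>Testing for a vector and preparing an output\<close>

text \<open>The first Kraus operator is \<open>|c><t|\<close>: it tests for \<open>t\<close> and
  leaves the fresh state \<open>c\<close>, of any dimension. The second is the complementary
  projector.\<close>

definition test_and_prepare :: "complex vec \<Rightarrow> complex vec \<Rightarrow> 'r \<Rightarrow> 'r \<Rightarrow> 'r protocol" where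
  "test_and_prepare t c y n =
    Operation [(mat (dim_vec c) (dim_vec t) (\<lambda>(i, j). c $ i * cnj (t $ j)), Return y),
      (1\<^sub>m (dim_vec t) - ket_bra t, Return n)]"

text \<open>As \<open>c\<close> has norm one, \<open>|c><t|\<close> contributes exactly
  \<open>|t><t|\<close> to the completeness sum, and the complementary projector is self-adjoint and
  idempotent, so it contributes the rest.\<close>

lemma well_formed_test_and_prepare:
  assumes "unit_state d t" "vnorm c = 1"
  shows "well_formed d (test_and_prepare t c y n)"
proof -
  define K where "K = mat (dim_vec c) (dim_vec t) (\<lambda>(i, j). c $ i * cnj (t $ j))"
  have d: "dim_vec t = d" and tt: "t \<bullet>c t = 1" and cc: "c \<bullet>c c = 1"
    using assms by (auto simp: unit_state_def cscalar_prod_self)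
  have K: "mat_adjoint K * K = ket_bra t"
  proof (rule eq_matI)
    fix i j assume "i < dim_row (ket_bra t)" "j < dim_col (ket_bra t)"
    then have ij: "i < dim_vec t" "j < dim_vec t" by auto
    have "(mat_adjoint K * K) $$ (i, j) = (\<Sum>k<dim_vec c. cnj (c $ k * cnj (t $ i)) * (c $ k * cnj (t $ j)))"
      using ij by (simp add: K_def scalar_prod_def lessThan_atLeast0)
    also have "\<dots> = t $ i * cnj (t $ j) * (c \<bullet>c c)"
      by (simp add: cscalar_prod_eq sum_distrib_left mult_ac)
    finally show "(mat_adjoint K * K) $$ (i, j) = ket_bra t $$ (i, j)" using ij cc by simp
  qed (simp_all add: K_def)
  have adj: "mat_adjoint (1\<^sub>m d - ket_bra t) = 1\<^sub>m d - ket_bra t"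
    by (rule eq_matI) (auto simp: d)
  have P: "ket_bra t \<in> carrier_mat d d" by (auto simp: d)
  have PP: "ket_bra t * ket_bra t = ket_bra t"
  proof (rule eq_matI)
    fix i j assume "i < dim_row (ket_bra t)" "j < dim_col (ket_bra t)"
    then have ij: "i < dim_vec t" "j < dim_vec t" by auto
    have "(ket_bra t * ket_bra t) $$ (i, j) = t $ i * cnj (t $ j) * (t \<bullet>c t)"
      using ij by (simp add: scalar_prod_def lessThan_atLeast0 cscalar_prod_eq sum_distrib_left mult_ac)
    then show "(ket_bra t * ket_bra t) $$ (i, j) = ket_bra t $$ (i, j)" using ij tt by simp
  qed simp_all
  have "(1\<^sub>m d - ket_bra t) * (1\<^sub>m d - ket_bra t) = 1\<^sub>m d - ket_bra t"
  proof -
    have "(1\<^sub>m d - ket_bra t) * (1\<^sub>m d - ket_bra t) =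
        1\<^sub>m d * (1\<^sub>m d - ket_bra t) - ket_bra t * (1\<^sub>m d - ket_bra t)"
      using P by (intro minus_mult_distrib_mat[of _ d d _ _ d]) (auto intro: minus_carrier_mat)
    also have "ket_bra t * (1\<^sub>m d - ket_bra t) = ket_bra t * 1\<^sub>m d - ket_bra t * ket_bra t"
      using P by (intro mult_minus_distrib_mat[of _ d d _ d]) (auto intro: minus_carrier_mat)
    finally show ?thesis using P by (simp add: PP) (rule eq_matI, auto)
  qed
  moreover have "ket_bra t + (1\<^sub>m d - ket_bra t) = 1\<^sub>m d"
    by (rule eq_matI) (auto simp: d)
  moreover have "(1\<^sub>m d - ket_bra t) + 0\<^sub>m d d = 1\<^sub>m d - ket_bra t"
    by (rule eq_matI) (auto simp: d)
  ultimately have "complete_kraus d [K, 1\<^sub>m d - ket_bra t]"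
    using P by (simp add: complete_kraus_def K adj d K_def[THEN arg_cong[of _ _ dim_col]])
  then show ?thesis by (simp add: test_and_prepare_def K_def d)
qed

lemma admissible_test_and_prepare: "admissible T (test_and_prepare t c y n) P"
  by (simp add: test_and_prepare_def)

lemma uses_test_and_prepare: "uses (test_and_prepare t c y n) = 0"
  by (simp add: test_and_prepare_def)

lemma result_prob_test_and_prepare:
  assumes "dim_vec s = dim_vec t" "vnorm c = 1" "\<And>P. (n, P) \<notin> E"
  shows "result_prob T (test_and_prepare t c y n) (ket_bra s) E =
    (if (y, ket_bra c) \<in> E then (cmod (s \<bullet>c t))\<^sup>2 else 0)"
proof -
  define K where "K = mat (dim_vec c) (dim_vec t) (\<lambda>(i, j). c $ i * cnj (t $ j))"
  have "K *\<^sub>v s = (s \<bullet>c t) \<cdot>\<^sub>v c"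
    using assms(1) by (intro eq_vecI)
      (auto simp: K_def scalar_prod_def sum_distrib_left sum_distrib_right mult_ac intro!: sum.cong)
  moreover have "dim_col K = dim_vec s" using assms by (simp add: K_def)
  ultimately have "branch_prob K (ket_bra s) = (cmod (s \<bullet>c t))\<^sup>2"
    "s \<bullet>c t \<noteq> 0 \<Longrightarrow> branch_state K (ket_bra s) = ket_bra c"
    using assms(2) by (simp_all add: branch_prob_ket_bra branch_state_ket_bra vnorm_smult
        ket_bra_normalize_smult)
  \<comment> \<open>If \<open>s\<close> is orthogonal to \<open>t\<close>, the branch state is a
    meaningless value from division by zero, but it enters with weight zero.\<close>
  then show ?thesis
    using assms(3) by (cases "s \<bullet>c t = 0") (simp_all add: test_and_prepare_def K_def[symmetric])
qed

section \<open>Choosing a protocol at random\<close>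

text \<open>A classical coin is written as an operation with equal multiples of the identity as
  Kraus operators: each branch has the squared scale as probability and leaves the state
  intact.\<close>

definition uniform_choice :: "nat \<Rightarrow> 'r protocol list \<Rightarrow> 'r protocol" where
  "uniform_choice d qs =
    Operation (map (Pair (complex_of_real (1 / sqrt (real (length qs))) \<cdot>\<^sub>m 1\<^sub>m d)) qs)"

lemma well_formed_uniform_choice:
  assumes "qs \<noteq> []" "\<And>q. q \<in> set qs \<Longrightarrow> well_formed d q"
  shows "well_formed d (uniform_choice d qs)"
proof -
  define c where "c = complex_of_real (1 / sqrt (real (length qs)))"
  have "mat_adjoint (c \<cdot>\<^sub>m 1\<^sub>m d) * (c \<cdot>\<^sub>m 1\<^sub>m d) = (cnj c * c) \<cdot>\<^sub>m 1\<^sub>m d"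
  proof -
    have "mat_adjoint (c \<cdot>\<^sub>m 1\<^sub>m d) = cnj c \<cdot>\<^sub>m 1\<^sub>m d" by (rule eq_matI) auto
    then show ?thesis by (simp add: mult_smult_assoc_mat[of _ d d _ d] mult_smult_distrib[of _ d d _ d])
        (rule eq_matI, auto)
  qed
  moreover have "cnj c * c = complex_of_real (1 / real (length qs))"
    by (simp add: c_def flip: of_real_mult)
  ultimately have sq: "mat_adjoint (c \<cdot>\<^sub>m 1\<^sub>m d) * (c \<cdot>\<^sub>m 1\<^sub>m d) =
      complex_of_real (1 / real (length qs)) \<cdot>\<^sub>m 1\<^sub>m d" by simp
  have "foldr (+) (map (\<lambda>_. a \<cdot>\<^sub>m 1\<^sub>m d) xs) (0\<^sub>m d d) = (of_nat (length xs) * a) \<cdot>\<^sub>m 1\<^sub>m d"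
    for a :: complex and xs :: "'a protocol list"
    by (induction xs) (auto intro!: eq_matI simp: algebra_simps)
  from this[of "complex_of_real (1 / real (length qs))" qs]
  have "complete_kraus d (map (\<lambda>_. c \<cdot>\<^sub>m 1\<^sub>m d) qs)"
    using assms(1) by (auto simp: complete_kraus_def comp_def sq intro!: eq_matI)
  then show ?thesis
    using assms(2) by (auto simp: uniform_choice_def comp_def c_def)
qed

lemma branch_scaled_one:
  assumes "unit_state d s" "c \<noteq> 0"
  shows "branch_prob (c \<cdot>\<^sub>m 1\<^sub>m d) (ket_bra s) = (cmod c)\<^sup>2"
    and "branch_state (c \<cdot>\<^sub>m 1\<^sub>m d) (ket_bra s) = ket_bra s"
proof -
  have "(c \<cdot>\<^sub>m 1\<^sub>m d) *\<^sub>v s = c \<cdot>\<^sub>v s" "dim_vec s = d" "vnorm s = 1"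
    using assms by (auto simp: unit_state_def intro!: eq_vecI)
  then show "branch_prob (c \<cdot>\<^sub>m 1\<^sub>m d) (ket_bra s) = (cmod c)\<^sup>2"
    and "branch_state (c \<cdot>\<^sub>m 1\<^sub>m d) (ket_bra s) = ket_bra s"
    using assms(2)
    by (simp_all add: branch_prob_ket_bra branch_state_ket_bra vnorm_smult ket_bra_normalize_smult)
qed

lemma admissible_uniform_choice:
  assumes "unit_state d s" "\<And>q. q \<in> set qs \<Longrightarrow> admissible T q (ket_bra s)"
  shows "admissible T (uniform_choice d qs) (ket_bra s)"
  using assms by (cases "qs = []") (auto simp: uniform_choice_def branch_scaled_one simp del: of_real_divide)

lemma result_prob_uniform_choice:
  assumes "unit_state d s"
  shows "result_prob T (uniform_choice d qs) (ket_bra s) E =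
    (\<Sum>q\<leftarrow>qs. result_prob T q (ket_bra s) E) / real (length qs)"
proof (cases "qs = []")
  case False
  define c where "c = complex_of_real (1 / sqrt (real (length qs)))"
  have "c \<noteq> 0" "(cmod c)\<^sup>2 = 1 / real (length qs)"
    using False by (auto simp: c_def norm_divide power_divide)
  then have "result_prob T (uniform_choice d qs) (ket_bra s) E =
      (\<Sum>q\<leftarrow>qs. 1 / real (length qs) * result_prob T q (ket_bra s) E)"
    using assms unfolding uniform_choice_def c_def[symmetric]
    by (simp add: branch_scaled_one comp_def)
  also have "\<dots> = (\<Sum>q\<leftarrow>qs. result_prob T q (ket_bra s) E) / real (length qs)"
    by (simp add: divide_inverse mult.commute sum_list_const_mult)
  finally show ?thesis .
qed (simp add: uniform_choice_def)

lemma uses_uniform_choice: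
  "(\<And>q. q \<in> set qs \<Longrightarrow> uses q = 0) \<Longrightarrow> uses (uniform_choice d qs) = 0"
proof -
  have "(\<And>q. q \<in> set qs \<Longrightarrow> uses q = 0) \<Longrightarrow>
      foldr max (map (\<lambda>(K, q). uses q) (map (Pair K) qs)) 0 = 0" for K :: "complex mat"
    by (induction qs) auto
  then show "(\<And>q. q \<in> set qs \<Longrightarrow> uses q = 0) \<Longrightarrow> uses (uniform_choice d qs) = 0"
    by (simp add: uniform_choice_def)
qed

section \<open>Cloning\<close>

lemma superposition_carrier:
  assumes "strong_phase_access T" "d > 0" "ray d P" "ray d Q"
  shows "superposition T d P Q \<in> carrier_vec d"
  using assms by (auto simp: strong_phase_access_def phase_convention_def superposition_def unit_state_def)

lemma convention_phase:
  assumes "strong_phase_access T" "d > 0" "unit_state d v"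
  obtains r where "cmod r = 1" "convention T d (ket_bra v) = r \<cdot>\<^sub>v v"
  using assms ket_bra_eq_imp_phase[of d "convention T d (ket_bra v)" v]
  unfolding strong_phase_access_def phase_convention_def by (metis ray_ket_bra)

text \<open>The \<open>t i\<close> need not be mutually orthogonal, so one of them is picked at
  random and tested. By duality the test for \<open>t i\<close> can succeed only on input
  \<open>\<psi> i\<close>, and does so with positive probability there; hence preparing two copies
  of \<open>\<psi> i\<close> after a success is never wrong.\<close>

lemma cloning_protocol:
  fixes m :: nat and \<psi> t :: "nat \<Rightarrow> complex vec"
  assumes T: "strong_phase_access T" "d > 0" and m: "m > 0" and u: "unit_state d u"
    and \<psi>: "\<And>j. j < m \<Longrightarrow> unit_state d (\<psi> j)" and t: "\<And>j. j < m \<Longrightarrow> unit_state d (t j)"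
    and nz: "\<And>j. j < m \<Longrightarrow> superposition T d (ket_bra (\<psi> j)) (ket_bra u) \<noteq> 0\<^sub>v d"
    and dual: "\<And>i j. i < m \<Longrightarrow> j < m \<Longrightarrow>
      superposition T d (ket_bra (\<psi> j)) (ket_bra u) \<bullet>c t i = 0 \<longleftrightarrow> i \<noteq> j"
  obtains q where "well_formed d q" "uses q = 1" "\<And>j. j < m \<Longrightarrow> clones T q (\<psi> j)"
proof -
  define c where "c i = tensor_vec (\<psi> i) (\<psi> i)" for i
  define q where "q = superpose_with d u
    (uniform_choice d (map (\<lambda>i. test_and_prepare (t i) (c i) True False) [0..<m])) False"
  have c: "vnorm (c i) = 1" if "i < m" for i
    using unit_state_tensor[OF \<psi>[OF that] \<psi>[OF that]] by (simp add: c_def unit_state_def)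
  have wf: "well_formed d q"
    unfolding q_def using m u t c
    by (intro well_formed_superpose_with well_formed_uniform_choice)
      (auto intro!: well_formed_test_and_prepare)
  have uses: "uses q = 1"
    unfolding q_def uses_superpose_with
    by (subst uses_uniform_choice) (auto simp: uses_test_and_prepare)
  have "clones T q (\<psi> j)" if j: "j < m" for j
  proof -
    define S where "S = superposition T d (ket_bra (\<psi> j)) (ket_bra u)"
    define p where "p = success_prob T d (ket_bra (\<psi> j)) (ket_bra u)"
    have S: "S \<in> carrier_vec d" "S \<noteq> 0\<^sub>v d"
      using superposition_carrier[OF T] \<psi>[OF j] u nz[OF j] by (auto simp: S_def ray_ket_bra)
    note sup = superpose_with_ket_bra[OF T \<psi>[OF j] u nz[OF j], folded S_def p_def]
    note unit_S = unit_state_normalize[OF S]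
    define a where "a i = (cmod (normalize_vec S \<bullet>c t i))\<^sup>2" for i
    have a: "a i = 0 \<longleftrightarrow> i \<noteq> j" if "i < m" for i
      using dual[OF that j, folded S_def] normalize_cscalar_prod_eq_0[OF S(1) _ S(2), of "t i"] t[OF that]
      by (auto simp: a_def unit_state_def)
    \<comment> \<open>For events without \<open>False\<close> only the successful tests count, so
      the probability is \<open>p\<close> times the average of the overlaps \<open>a i\<close>, of
      which \<open>a j\<close> alone is nonzero.\<close>
    have prob: "result_prob T q (ket_bra (\<psi> j)) E =
        p * ((\<Sum>i<m. if (True, ket_bra (c i)) \<in> E then a i else 0) / real m)"
      if E: "\<And>P. (False, P) \<notin> E" for E
    proof -
      have "result_prob T (test_and_prepare (t i) (c i) True False) (ket_bra (normalize_vec S)) E =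
          (if (True, ket_bra (c i)) \<in> E then a i else 0)" if "i < m" for i
        using t[OF that] c[OF that] unit_S E unfolding a_def
        by (intro result_prob_test_and_prepare) (auto simp: unit_state_def)
      then have "(\<Sum>i\<leftarrow>[0..<m]. result_prob T (test_and_prepare (t i) (c i) True False)
          (ket_bra (normalize_vec S)) E) = (\<Sum>i<m. if (True, ket_bra (c i)) \<in> E then a i else 0)"
        by (simp add: interv_sum_list_conv_sum_set_nat lessThan_atLeast0)
      then show ?thesis
        unfolding q_def using sup(3)[OF E] by (simp add: result_prob_uniform_choice[OF unit_S] comp_def)
    qed
    have "admissible T q (ket_bra (\<psi> j))"
      unfolding q_def sup(2) using unit_S
      by (intro admissible_uniform_choice) (auto intro: admissible_test_and_prepare)
    moreover have "result_prob T q (ket_bra (\<psi> j)) {(r, P). r} > 0"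
    proof -
      have "0 < a j" using a[OF j] by (simp add: a_def)
      also have "\<dots> \<le> (\<Sum>i<m. a i)" using j by (intro member_le_sum) (auto simp: a_def)
      finally show ?thesis using m sup(1) by (subst prob) auto
    qed
    moreover have "result_prob T q (ket_bra (\<psi> j))
        {(r, P). r \<and> P \<noteq> ket_bra (tensor_vec (\<psi> j) (\<psi> j))} = 0"
    proof -
      have "(\<Sum>i<m. if (True, ket_bra (c i)) \<in> {(r, P). r \<and> P \<noteq> ket_bra (c j)} then a i else 0) = 0"
        by (rule sum.neutral) (use a in auto)
      moreover have "tensor_vec (\<psi> j) (\<psi> j) = c j" by (simp add: c_def)
      ultimately show ?thesis by (subst prob) auto
    qed
    ultimately show ?thesis by (simp add: clones_def)
  qed
  with wf uses show thesis by (rule that)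
qed

text \<open>Dependence in the module sense attaches coefficients to vectors rather than to indices.
  Injectivity of \<open>\<psi>\<close> lets the indexed coefficients be carried over along its
  inverse, since otherwise repeated vectors would merge in the image.\<close>

lemma lin_dep_image:
  fixes \<psi> :: "nat \<Rightarrow> complex vec"
  assumes "\<And>j. j < m \<Longrightarrow> \<psi> j \<in> carrier_vec d" "inj_on \<psi> {..<m}"
    and "\<And>i. i < d \<Longrightarrow> (\<Sum>j<m. c j * \<psi> j $ i) = 0" "j < m" "c j \<noteq> 0"
  shows "module.lin_dep class_ring (module_vec TYPE(complex) d) (\<psi> ` {..<m})"
proof -
  interpret vec_space "TYPE(complex)" d .
  define a where "a v = c (the_inv_into {..<m} \<psi> v)" for v
  have a: "a (\<psi> j) = c j" if "j < m" for j
    using that assms(2) by (simp add: a_def the_inv_into_f_f)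
  have car: "\<psi> ` {..<m} \<subseteq> carrier_vec d" using assms(1) by auto
  have "lincomb a (\<psi> ` {..<m}) = 0\<^sub>v d"
  proof (rule eq_vecI)
    fix i assume "i < dim_vec (0\<^sub>v d :: complex vec)"
    then have i: "i < d" by simp
    have "lincomb a (\<psi> ` {..<m}) $ i = (\<Sum>v\<in>\<psi> ` {..<m}. a v * v $ i)"
      by (rule lincomb_index[OF i car])
    also have "\<dots> = 0"
      using assms(3)[OF i] by (simp add: sum.reindex[OF assms(2)] a)
    finally show "lincomb a (\<psi> ` {..<m}) $ i = 0\<^sub>v d $ i" using i by simp
  qed (use lincomb_dim[OF _ car] in auto)
  then show ?thesis
    unfolding lin_dep_def using assms(4,5) a
    by (intro exI[of _ "\<psi> ` {..<m}"] exI[of _ a] exI[of _ "\<psi> j"]) (auto simp: module_vec_simps)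
qed

section \<open>Vectors with three coordinates\<close>

definition ket3 :: "complex \<Rightarrow> complex \<Rightarrow> complex \<Rightarrow> complex vec" where
  "ket3 a b c = vec 3 (\<lambda>i. if i = 0 then a else if i = 1 then b else c)"

lemma sum_lessThan_3: "(\<Sum>i<3. f i) = f 0 + f 1 + f (2::nat)" for f :: "nat \<Rightarrow> 'a::comm_monoid_add"
  by (simp add: eval_nat_numeral add.assoc)

lemma less_3_cases: "i < (3::nat) \<Longrightarrow> i = 0 \<or> i = 1 \<or> i = 2"
  by auto

lemma ket3_carrier [simp]: "ket3 a b c \<in> carrier_vec 3" "dim_vec (ket3 a b c) = 3"
  by (simp_all add: ket3_def)

lemma ket3_index [simp]: "ket3 a b c $ 0 = a" "ket3 a b c $ Suc 0 = b" "ket3 a b c $ 2 = c"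
  by (simp_all add: ket3_def)

lemma smult_ket3: "x \<cdot>\<^sub>v ket3 a b c = ket3 (x * a) (x * b) (x * c)"
  by (rule eq_vecI) (auto simp: ket3_def)

lemma add_ket3: "ket3 a b c + ket3 a' b' c' = ket3 (a + a') (b + b') (c + c')"
  by (rule eq_vecI) (auto simp: ket3_def)

lemma ket3_cscalar_prod: "ket3 a b c \<bullet>c ket3 a' b' c' = a * cnj a' + b * cnj b' + c * cnj c'"
  by (simp add: cscalar_prod_eq sum_lessThan_3)

lemma unit_state_ket3: "unit_state 3 (ket3 a b c) \<longleftrightarrow> (cmod a)\<^sup>2 + (cmod b)\<^sup>2 + (cmod c)\<^sup>2 = 1"
  by (simp add: unit_state_iff sum_lessThan_3)

lemma ket3_nonzero: "c \<noteq> 0 \<Longrightarrow> ket3 a b c \<noteq> 0\<^sub>v 3"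
  by (metis index_zero_vec(1) ket3_index(3) less_add_one numeral_2_eq_2 numeral_3_eq_3 lessI)

section \<open>Steering\<close>

lemma steering_kraus_mult_vec:
  assumes "dim_vec \<Omega> = dim_vec e * n"
  shows "steering_kraus n e *\<^sub>v \<Omega> = vec n (\<lambda>i. \<Sum>a<dim_vec e. cnj (e $ a) * \<Omega> $ (a * n + i))"
proof (rule eq_vecI)
  fix i assume "i < dim_vec (vec n (\<lambda>i. \<Sum>a<dim_vec e. cnj (e $ a) * \<Omega> $ (a * n + i)))"
  then have i: "i < n" by simp
  \<comment> \<open>The index of \<open>\<Omega>\<close> is written as quotient and remainder so
    that the sum splits into Alice's index and Bob's, and the identity on Bob's side selects
    \<open>i\<close>.\<close>
  have "(steering_kraus n e *\<^sub>v \<Omega>) $ i =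
      (\<Sum>j<dim_vec e * n. cnj (e $ (j div n)) * (if i = j mod n then 1 else 0) *
        \<Omega> $ (j div n * n + j mod n))"
    using i assms by (auto simp: steering_kraus_def tensor_mat_def scalar_prod_def lessThan_atLeast0
        less_mult_imp_div_less mod_lt_of_lt_mult intro!: sum.cong)
  also have "\<dots> = (\<Sum>a<dim_vec e. \<Sum>b<n. cnj (e $ a) * (if i = b then 1 else 0) * \<Omega> $ (a * n + b))"
    by (rule sum_div_mod)
  also have "\<dots> = (\<Sum>a<dim_vec e. \<Sum>b<n. if i = b then cnj (e $ a) * \<Omega> $ (a * n + b) else 0)"
    by (intro sum.cong) auto
  finally show "(steering_kraus n e *\<^sub>v \<Omega>) $ i =
      vec n (\<lambda>i. \<Sum>a<dim_vec e. cnj (e $ a) * \<Omega> $ (a * n + i)) $ i"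
    using i by (simp add: sum.delta')
qed (simp add: steering_kraus_def tensor_mat_def)

lemma steered_branch:
  assumes "dim_vec \<Omega> = dim_vec e * n" "steering_kraus n e *\<^sub>v \<Omega> = c \<cdot>\<^sub>v v" "vnorm v = 1" "c \<noteq> 0"
  shows "branch_prob (steering_kraus n e) (ket_bra \<Omega>) = (cmod c)\<^sup>2"
    and "branch_state (steering_kraus n e) (ket_bra \<Omega>) = ket_bra v"
proof -
  have "dim_col (steering_kraus n e) = dim_vec \<Omega>"
    using assms(1) by (simp add: steering_kraus_def tensor_mat_def)
  then show "branch_prob (steering_kraus n e) (ket_bra \<Omega>) = (cmod c)\<^sup>2"
    and "branch_state (steering_kraus n e) (ket_bra \<Omega>) = ket_bra v"
    using assms by (simp_all add: branch_prob_ket_bra branch_state_ket_bra vnorm_smult ket_bra_normalize_smult)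
qed

section \<open>Cloning and signaling in dimension three\<close>

text \<open>The convention picks one phase on each coordinate axis. Absorbing these phases into the
  representatives makes the convention act as the identity on the three reference vectors.\<close>

lemma reference_phases:
  assumes T: "strong_phase_access T"
  obtains p q s where "cmod p = 1" "cmod q = 1" "cmod s = 1"
    "convention T 3 (ket_bra (ket3 p 0 0)) = ket3 p 0 0"
    "convention T 3 (ket_bra (ket3 0 q 0)) = ket3 0 q 0"
    "convention T 3 (ket_bra (ket3 0 0 s)) = ket3 0 0 s"
proof -
  have unit: "unit_state 3 (ket3 1 0 0)" "unit_state 3 (ket3 0 1 0)" "unit_state 3 (ket3 0 0 1)"
    by (simp_all add: unit_state_ket3)
  obtain p where p: "cmod p = 1" "convention T 3 (ket_bra (ket3 1 0 0)) = p \<cdot>\<^sub>v ket3 1 0 0"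
    by (rule convention_phase[OF T _ unit(1)]) simp_all
  obtain q where q: "cmod q = 1" "convention T 3 (ket_bra (ket3 0 1 0)) = q \<cdot>\<^sub>v ket3 0 1 0"
    by (rule convention_phase[OF T _ unit(2)]) simp_all
  obtain s where s: "cmod s = 1" "convention T 3 (ket_bra (ket3 0 0 1)) = s \<cdot>\<^sub>v ket3 0 0 1"
    by (rule convention_phase[OF T _ unit(3)]) simp_all
  show thesis
    using p q s that[of p q s] ket_bra_phase[OF p(1), of "ket3 1 0 0"]
      ket_bra_phase[OF q(1), of "ket3 0 1 0"] ket_bra_phase[OF s(1), of "ket3 0 0 1"]
    by (simp add: smult_ket3)
qed

text \<open>The reference occupies a coordinate that the plane of \<open>a\<close> and
  \<open>b\<close> does not reach, so the third entry \<open>beta T 3 * s\<close> survives for every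
  phase \<open>r\<close> and the superposition cannot vanish.\<close>

lemma superposition_ket3:
  assumes "strong_phase_access T" "cmod s = 1"
    "convention T 3 (ket_bra (ket3 0 0 s)) = ket3 0 0 s" "unit_state 3 (ket3 a b 0)"
  obtains r where "cmod r = 1" "convention T 3 (ket_bra (ket3 a b 0)) = ket3 (r * a) (r * b) 0"
    "superposition T 3 (ket_bra (ket3 a b 0)) (ket_bra (ket3 0 0 s)) =
      ket3 (alpha T 3 * r * a) (alpha T 3 * r * b) (beta T 3 * s)"
    "superposition T 3 (ket_bra (ket3 a b 0)) (ket_bra (ket3 0 0 s)) \<noteq> 0\<^sub>v 3"
proof -
  obtain r where r: "cmod r = 1" "convention T 3 (ket_bra (ket3 a b 0)) = r \<cdot>\<^sub>v ket3 a b 0"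
    by (rule convention_phase[OF assms(1) _ assms(4)]) simp_all
  have "s \<noteq> 0" using assms(2) by auto
  moreover have "beta T 3 \<noteq> 0" using assms(1) by (auto simp: strong_phase_access_def)
  ultimately show thesis
    using that[of r] r assms(3)
    by (simp add: superposition_def smult_ket3 add_ket3 ket3_nonzero mult.assoc)
qed

definition sqrt2 :: complex where "sqrt2 = complex_of_real (sqrt 2)"

lemma sqrt2_simps:
  "sqrt2 \<noteq> 0" "sqrt2 * sqrt2 = 2" "2 / sqrt2 = sqrt2" "cmod sqrt2 = sqrt 2" "cnj sqrt2 = sqrt2"
proof -
  show nz: "sqrt2 \<noteq> 0" and sq: "sqrt2 * sqrt2 = 2"
    by (simp_all add: sqrt2_def flip: of_real_mult)
  show "2 / sqrt2 = sqrt2" by (simp add: nonzero_divide_eq_eq[OF nz] sq)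
qed (simp_all add: sqrt2_def)

text \<open>Both claims rest on the same dual vectors: cloning tests for all three, signaling only
  for the third.\<close>

lemma cloning_and_signaling:
  assumes T: "strong_phase_access T"
  shows
    "\<exists>(d::nat) (m::nat) (\<psi>::nat \<Rightarrow> complex vec) (q::bool protocol).
      d > 0 \<and> (\<forall>j<m. unit_state d (\<psi> j)) \<and> inj_on (\<lambda>j. ket_bra (\<psi> j)) {..<m} \<and>
      module.lin_dep class_ring (module_vec TYPE(complex) d) (\<psi> ` {..<m}) \<and>
      well_formed d q \<and> uses q = 1 \<and> (\<forall>j<m. clones T q (\<psi> j))" (is ?cloning)
    "\<exists>dA dB \<Omega> meas (q::nat protocol).
      dA > 0 \<and> dB > 0 \<and> unit_state (dA * dB) \<Omega> \<and>
      (\<forall>b. rank_one_measurement dA (meas b)) \<and> well_formed dB q \<and> uses q \<ge> 1 \<and>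
      (\<forall>b. steered_admissible T dB \<Omega> (meas b) q) \<and>
      steered_distribution T dB \<Omega> (meas False) q \<noteq> steered_distribution T dB \<Omega> (meas True) q"
      (is ?signaling)
proof -
  define \<alpha> \<beta> where "\<alpha> = alpha T 3" and "\<beta> = beta T 3"
  have nz: "\<alpha> \<noteq> 0" "\<beta> \<noteq> 0" using T by (auto simp: strong_phase_access_def \<alpha>_def \<beta>_def)
  obtain p q s where pqs: "cmod p = 1" "cmod q = 1" "cmod s = 1"
    and conv: "convention T 3 (ket_bra (ket3 p 0 0)) = ket3 p 0 0"
      "convention T 3 (ket_bra (ket3 0 q 0)) = ket3 0 q 0"
      "convention T 3 (ket_bra (ket3 0 0 s)) = ket3 0 0 s"
    by (rule reference_phases[OF T])
  have pqs0: "p \<noteq> 0" "q \<noteq> 0" "s \<noteq> 0" using pqs by auto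
  define u where "u = ket3 0 0 s"
  define \<psi>0 \<psi>1 where "\<psi>0 = ket3 p 0 0" and "\<psi>1 = ket3 0 q 0"
  text \<open>The superpositions of \<open>\<psi>0\<close>, \<open>\<psi>1\<close>, \<open>\<psi>m\<close> with \<open>u\<close> are dependent only if the convention puts
    \<open>\<psi>m\<close> on the affine line through \<open>\<psi>0\<close> and \<open>\<psi>1\<close>. The minus sign excludes this for every phase.\<close>
  define \<psi>m \<psi>p where "\<psi>m = ket3 (p / sqrt2) (- (q / sqrt2)) 0" and "\<psi>p = ket3 (p / sqrt2) (q / sqrt2) 0"
  define sup where "sup v = superposition T 3 (ket_bra v) (ket_bra u)" for v
  have unit: "unit_state 3 u" "unit_state 3 \<psi>0" "unit_state 3 \<psi>1" "unit_state 3 \<psi>m" "unit_state 3 \<psi>p"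
    using pqs by (simp_all add: u_def \<psi>0_def \<psi>1_def \<psi>m_def \<psi>p_def unit_state_ket3 norm_divide
        sqrt2_simps power_divide)
  note sup_ket3 = superposition_ket3[OF T pqs(3) conv(3)]
  have sup0: "sup \<psi>0 = ket3 (\<alpha> * p) 0 (\<beta> * s)"
    by (simp add: sup_def superposition_def u_def \<psi>0_def \<alpha>_def \<beta>_def conv smult_ket3 add_ket3)
  have sup1: "sup \<psi>1 = ket3 0 (\<alpha> * q) (\<beta> * s)"
    by (simp add: sup_def superposition_def u_def \<psi>1_def \<alpha>_def \<beta>_def conv smult_ket3 add_ket3)
  obtain r where r: "cmod r = 1"
    and supm: "sup \<psi>m = ket3 (\<alpha> * r * (p / sqrt2)) (\<alpha> * r * - (q / sqrt2)) (\<beta> * s)"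
    using sup_ket3[OF unit(4)[unfolded \<psi>m_def]] unfolding sup_def u_def \<psi>m_def \<alpha>_def \<beta>_def by metis
  have r0: "r \<noteq> 0" using r by auto
  \<comment> \<open>The phase of \<open>\<psi>p\<close> stays unknown. Its superposition is nonzero
    for every phase, which makes the device admissible on it.\<close>
  have supp: "sup \<psi>p \<noteq> 0\<^sub>v 3"
    using sup_ket3[OF unit(5)[unfolded \<psi>p_def]] unfolding sup_def u_def \<psi>p_def by metis
  have sup_nz: "sup \<psi>0 \<noteq> 0\<^sub>v 3" "sup \<psi>1 \<noteq> 0\<^sub>v 3" "sup \<psi>m \<noteq> 0\<^sub>v 3"
    unfolding sup0 sup1 supm using nz pqs0 by (auto intro!: ket3_nonzero)
  \<comment> \<open>With third entry \<alpha> / s, orthogonality to the superposition of \<psi>0 or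
    of \<psi>1 fixes one entry of a dual vector; orthogonality to that of \<psi>m then shifts the
    other by the solution of \<open>r * \<kappa> = \<beta> * sqrt2\<close>.\<close>
  define \<kappa> where "\<kappa> = \<beta> * sqrt2 / r"
  text \<open>Up to normalization \<open>t0\<close>, \<open>t1\<close>, \<open>t2\<close> is the basis dual to the three superpositions.\<close>
  define t0 where "t0 = ket3 (cnj ((- \<beta> - \<kappa>) / p)) (cnj (- \<beta> / q)) (cnj (\<alpha> / s))"
  define t1 where "t1 = ket3 (cnj (- \<beta> / p)) (cnj ((- \<beta> + \<kappa>) / q)) (cnj (\<alpha> / s))"
  define t2 where "t2 = ket3 (cnj (\<beta> / p)) (cnj (\<beta> / q)) (cnj (- \<alpha> / s))"
  have \<kappa>: "\<kappa> \<noteq> 0" "r * \<kappa> = \<beta> * sqrt2" using nz r0 sqrt2_simps by (simp_all add: \<kappa>_def)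
  have dual0: "sup \<psi>0 \<bullet>c t0 = - (\<alpha> * \<kappa>)" "sup \<psi>1 \<bullet>c t0 = 0" "sup \<psi>m \<bullet>c t0 = 0"
    using pqs0 sqrt2_simps(1) \<kappa>(2)
    by (simp_all add: sup0 sup1 supm t0_def ket3_cscalar_prod field_simps del: complex_cnj_divide complex_cnj_diff)
  have dual1: "sup \<psi>0 \<bullet>c t1 = 0" "sup \<psi>1 \<bullet>c t1 = \<alpha> * \<kappa>" "sup \<psi>m \<bullet>c t1 = 0"
    using pqs0 sqrt2_simps(1) \<kappa>(2)
    by (simp_all add: sup0 sup1 supm t1_def ket3_cscalar_prod field_simps del: complex_cnj_divide complex_cnj_add)
  \<comment> \<open>The in-plane terms of the superposition of \<psi>m cancel against
    \<open>t2\<close>, so the unknown phase \<open>r\<close> drops out and only the reference term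
    is left.\<close>
  have dual2: "sup \<psi>0 \<bullet>c t2 = 0" "sup \<psi>1 \<bullet>c t2 = 0" "sup \<psi>m \<bullet>c t2 = - (\<alpha> * \<beta>)"
    using pqs0 sqrt2_simps(1)
    by (simp_all add: sup0 sup1 supm t2_def ket3_cscalar_prod field_simps del: complex_cnj_divide)
  have t_nz: "t0 \<noteq> 0\<^sub>v 3" "t1 \<noteq> 0\<^sub>v 3" "t2 \<noteq> 0\<^sub>v 3"
    unfolding t0_def t1_def t2_def using nz pqs0 by (auto intro!: ket3_nonzero)
  have t_car: "t0 \<in> carrier_vec 3" "t1 \<in> carrier_vec 3" "t2 \<in> carrier_vec 3"
    by (simp_all add: t0_def t1_def t2_def)
  have sup_car: "sup v \<in> carrier_vec 3" if "unit_state 3 v" for v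
    using superposition_carrier[OF T] that unit(1) by (simp add: sup_def ray_ket_bra)

  show ?cloning
  proof -
    define \<psi> where "\<psi> j = (if j = 0 then \<psi>0 else if j = 1 then \<psi>1 else \<psi>m)" for j :: nat
    define t where "t j = normalize_vec (if j = 0 then t0 else if j = 1 then t1 else t2)" for j :: nat
    have \<psi>: "unit_state 3 (\<psi> j)" for j using unit by (simp add: \<psi>_def)
    have t: "unit_state 3 (t j)" for j
      using t_nz t_car by (auto simp: t_def intro: unit_state_normalize)
    have nzj: "sup (\<psi> j) \<noteq> 0\<^sub>v 3" for j using sup_nz by (simp add: \<psi>_def)
    have dual: "sup (\<psi> j) \<bullet>c t i = 0 \<longleftrightarrow> i \<noteq> j" if "i < 3" "j < 3" for i j
    proof -
      have "sup (\<psi> j) \<bullet>c t i = 0 \<longleftrightarrow>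
          sup (\<psi> j) \<bullet>c (if i = 0 then t0 else if i = 1 then t1 else t2) = 0"
        unfolding t_def using sup_car[OF \<psi>] t_nz t_car
        by (intro cscalar_prod_normalize_eq_0[of _ 3]) auto
      then show ?thesis
        using less_3_cases[OF that(1)] less_3_cases[OF that(2)] dual0 dual1 dual2 \<kappa> nz
        by (auto simp: \<psi>_def)
    qed
    obtain Q where Q: "well_formed 3 Q" "uses Q = 1" "\<And>j. j < 3 \<Longrightarrow> clones T Q (\<psi> j)"
      by (rule cloning_protocol[OF T _ _ unit(1) \<psi> t nzj[unfolded sup_def] dual[unfolded sup_def], of 3])
        simp_all
    \<comment> \<open>A single diagonal entry, taking the values 1, 0 and 1/2, separates the three
      rays.\<close>
    have entry: "ket_bra (\<psi> j) $$ (0, 0) = (if j = 0 then 1 else if j = 1 then 0 else 1 / 2)" for j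
    proof -
      have "p * cnj p = 1" using pqs by (simp flip: complex_norm_square)
      then show ?thesis
        by (simp add: \<psi>_def \<psi>0_def \<psi>1_def \<psi>m_def sqrt2_simps)
    qed
    have inj: "inj_on (\<lambda>j. ket_bra (\<psi> j)) {..<3}"
    proof (rule inj_onI)
      fix i j assume "i \<in> {..<3::nat}" "j \<in> {..<3::nat}" and "ket_bra (\<psi> i) = ket_bra (\<psi> j)"
      then show "i = j" using entry[of i] entry[of j] less_3_cases[of i] less_3_cases[of j] by auto
    qed
    \<comment> \<open>The coefficients of the relation \<psi>0 - \<psi>1 - \<open>sqrt2\<close>
      \<psi>m = 0.\<close>
    define c :: "nat \<Rightarrow> complex" where "c j = (if j = 0 then 1 else if j = 1 then - 1 else - sqrt2)" for j
    have lin_dep: "module.lin_dep class_ring (module_vec TYPE(complex) 3) (\<psi> ` {..<3})"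
    proof (rule lin_dep_image)
      show "inj_on \<psi> {..<3}" using inj by (auto simp: inj_on_def)
      show "(\<Sum>j<3. c j * \<psi> j $ i) = 0" if "i < 3" for i
        using less_3_cases[OF that]
        by (auto simp: sum_lessThan_3 c_def \<psi>_def \<psi>0_def \<psi>1_def \<psi>m_def sqrt2_simps)
      show "c 0 \<noteq> 0" "0 < (3::nat)" by (simp_all add: c_def)
    qed (use \<psi> in \<open>simp add: unit_state_def\<close>)
    show ?thesis
      by (rule exI[of _ "3::nat"], rule exI[of _ "3::nat"], rule exI[of _ \<psi>], rule exI[of _ Q])
        (use Q \<psi> inj lin_dep in simp)
  qed

  show ?signaling
  proof -
    define t where "t = normalize_vec t2"
    have t: "unit_state 3 t" unfolding t_def using t_car t_nz by (intro unit_state_normalize)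
    define Q :: "nat protocol" where "Q = superpose_with 3 u (test_and_prepare t t 1 0) 0"
    \<comment> \<open>Positions 0 and 4 are the pairs (0, 0) and (1, 1), since Bob's dimension is 3.
      Up to the factor \<open>1 / sqrt2\<close> this is |0> with \<psi>0 plus |1> with \<psi>1, so
      Alice's computational basis steers to \<psi>0, \<psi>1 and the Hadamard basis to \<psi>p,
      \<psi>m, each with probability 1/2.\<close>
    define \<Omega> where "\<Omega> = vec 6 (\<lambda>k. if k = 0 then p / sqrt2 else if k = 4 then q / sqrt2 else 0)"
    define e where "e a b = vec 2 (\<lambda>i. if i = 0 then a else b)" for a b :: complex
    define meas where "meas b = (if b then [e (1 / sqrt2) (1 / sqrt2), e (1 / sqrt2) (- (1 / sqrt2))]
      else [e 1 0, e 0 1])" for b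
    have \<Omega>: "unit_state (2 * 3) \<Omega>"
      using pqs by (simp add: unit_state_iff \<Omega>_def eval_nat_numeral norm_divide sqrt2_simps power_divide)
    have meas: "rank_one_measurement 2 (meas b)" for b
    proof -
      have "e a b \<noteq> 0\<^sub>v 2" if "a \<noteq> 0 \<or> b \<noteq> 0" for a b
        using that by (auto simp: e_def vec_eq_iff less_2_cases_iff)
      moreover have "foldr (+) (map ket_bra (meas b)) (0\<^sub>m 2 2) = 1\<^sub>m 2"
        by (rule eq_matI) (auto simp: meas_def e_def less_2_cases_iff sqrt2_simps)
      ultimately show ?thesis
        by (auto simp: rank_one_measurement_def meas_def sqrt2_simps) (simp_all add: e_def)
    qed
    have steer: "steering_kraus 3 (e a b) *\<^sub>v \<Omega> = ket3 (cnj a * p / sqrt2) (cnj b * q / sqrt2) 0" for a b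
    proof -
      have "dim_vec \<Omega> = dim_vec (e a b) * 3" by (simp add: \<Omega>_def e_def)
      note this[THEN steering_kraus_mult_vec]
      then show ?thesis
        by (intro eq_vecI) (auto simp: ket3_def \<Omega>_def e_def eval_nat_numeral less_Suc_eq)
    qed
    have branch: "branch_prob (steering_kraus 3 (e a b)) (ket_bra \<Omega>) = 1 / 2"
      "branch_state (steering_kraus 3 (e a b)) (ket_bra \<Omega>) = ket_bra v"
      if "unit_state 3 v" "v = ket3 (cnj a * p) (cnj b * q) 0" for a b v
      using steered_branch[of \<Omega> "e a b" 3 "1 / sqrt2" v] that steer[of a b]
      by (simp_all add: \<Omega>_def e_def smult_ket3 unit_state_def sqrt2_simps norm_divide power_divide)
    have bstates: "\<psi>0 = ket3 (cnj 1 * p) (cnj 0 * q) 0" "\<psi>1 = ket3 (cnj 0 * p) (cnj 1 * q) 0"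
      "\<psi>p = ket3 (cnj (1 / sqrt2) * p) (cnj (1 / sqrt2) * q) 0"
      "\<psi>m = ket3 (cnj (1 / sqrt2) * p) (cnj (- (1 / sqrt2)) * q) 0"
      by (simp_all add: \<psi>0_def \<psi>1_def \<psi>p_def \<psi>m_def sqrt2_simps)
    note branches = branch[OF unit(2) bstates(1)] branch[OF unit(3) bstates(2)]
      branch[OF unit(5) bstates(3)] branch[OF unit(4) bstates(4)]
    define P where "P v = result_prob T Q (ket_bra v) {(r', P). r' = 1}" for v
    have P: "admissible T Q (ket_bra v)" "0 \<le> P v" "P v = 0 \<longleftrightarrow> sup v \<bullet>c t2 = 0"
      if v: "unit_state 3 v" "sup v \<noteq> 0\<^sub>v 3" for v
    proof -
      note device = superpose_with_ket_bra[OF T _ v(1) unit(1) v(2)[unfolded sup_def], simplified]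
      show "admissible T Q (ket_bra v)"
        unfolding Q_def device(2) by (rule admissible_test_and_prepare)
      have S: "unit_state 3 (normalize_vec (sup v))"
        using v sup_car by (intro unit_state_normalize) auto
      \<comment> \<open>Failure of the device and failure of the test both report 0, so outcome 1
        requires both to succeed. As the device succeeds with positive probability,
        \<open>P v\<close> vanishes exactly on orthogonality to \<open>t2\<close>.\<close>
      have "P v = success_prob T 3 (ket_bra v) (ket_bra u) * (cmod (normalize_vec (sup v) \<bullet>c t))\<^sup>2"
        unfolding P_def Q_def using t S
        by (subst device(3)) (auto simp: result_prob_test_and_prepare unit_state_def sup_def)
      moreover have "normalize_vec (sup v) \<bullet>c t = 0 \<longleftrightarrow> sup v \<bullet>c t2 = 0"
        using normalize_cscalar_prod_eq_0[OF sup_car[OF v(1)] _ v(2), of t]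
          cscalar_prod_normalize_eq_0[OF sup_car[OF v(1)] t_car(3) t_nz(3)] t
        by (simp add: t_def unit_state_def)
      ultimately show "0 \<le> P v" "P v = 0 \<longleftrightarrow> sup v \<bullet>c t2 = 0"
        using device(1) by auto
    qed
    \<comment> \<open>On the first ensemble outcome 1 never occurs. On the second the \<psi>m term
      is positive, and the \<psi>p term cannot cancel it because it is nonnegative.\<close>
    have "P \<psi>0 = 0" "P \<psi>1 = 0" "P \<psi>m \<noteq> 0" "P \<psi>p \<ge> 0" "P \<psi>m \<ge> 0"
      using P unit sup_nz supp dual2 nz by auto
    moreover have "steered_distribution T 3 \<Omega> (meas False) Q 1 = (P \<psi>0 + P \<psi>1) / 2"
      "steered_distribution T 3 \<Omega> (meas True) Q 1 = (P \<psi>p + P \<psi>m) / 2"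
      by (simp_all add: steered_distribution_def meas_def branches P_def)
    ultimately have "steered_distribution T 3 \<Omega> (meas False) Q 1 \<noteq>
        steered_distribution T 3 \<Omega> (meas True) Q 1" by auto
    then have "steered_distribution T 3 \<Omega> (meas False) Q \<noteq> steered_distribution T 3 \<Omega> (meas True) Q"
      by metis
    moreover have "steered_admissible T 3 \<Omega> (meas b) Q" for b
      using P(1) unit sup_nz supp by (simp add: steered_admissible_def meas_def branches)
    moreover have "well_formed 3 Q"
      unfolding Q_def using unit(1) t
      by (intro well_formed_superpose_with well_formed_test_and_prepare) (auto simp: unit_state_def)
    moreover have "uses Q \<ge> 1" by (simp add: Q_def uses_superpose_with)
    ultimately show ?thesis using \<Omega> meas
      by (intro exI[of _ 2] exI[of _ 3] exI[of _ \<Omega>] exI[of _ meas] exI[of _ Q]) auto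
  qed
qed

section \<open>Search by reflections about the current state\<close>

text \<open>The real unit circle spanned by the marked basis vector and the uniform superposition of
  the others, with \<theta> measured from the latter.\<close>

definition grover_state :: "nat \<Rightarrow> nat \<Rightarrow> real \<Rightarrow> complex vec" where
  "grover_state N w \<theta> =
    vec N (\<lambda>i. complex_of_real (if i = w then sin \<theta> else cos \<theta> / sqrt (real N - 1)))"

lemma grover_state_cscalar_prod:
  assumes "w < N" "N \<ge> 2"
  shows "grover_state N w a \<bullet>c grover_state N w b = complex_of_real (cos (a - b))"
proof -
  have "grover_state N w a \<bullet>c grover_state N w b =
      (\<Sum>i<N. complex_of_real (if i = w then sin a * sin b else cos a * cos b / (real N - 1)))"
    using assms by (auto simp: cscalar_prod_eq grover_state_def simp flip: of_real_mult intro!: sum.cong)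
  also have "\<dots> = complex_of_real (sin a * sin b + (\<Sum>i\<in>{..<N} - {w}. cos a * cos b / (real N - 1)))"
    using assms by (simp add: sum.remove[of "{..<N}" w])
  also have "\<dots> = complex_of_real (cos (a - b))"
    using assms by (simp add: cos_diff of_nat_diff)
  finally show ?thesis .
qed

lemma unit_grover_state:
  assumes "w < N" "N \<ge> 2"
  shows "unit_state N (grover_state N w \<theta>)"
  unfolding unit_state_iff_cscalar grover_state_cscalar_prod[OF assms]
  by (simp add: grover_state_def)

lemma grover_state_oracle:
  assumes "w < N"
  shows "phase_oracle N (marked w) *\<^sub>v grover_state N w \<theta> = grover_state N w (- \<theta>)"
  using assms
  by (intro eq_vecI) (auto simp: phase_oracle_def marked_def grover_state_def scalar_prod_def
      if_distrib[of "\<lambda>x. x * _"] sum.delta cong: if_cong)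

lemma grover_state_reflect:
  assumes R: "reflection_access R" and "w < N" "N \<ge> 2"
  shows "R N (ket_bra (grover_state N w a)) *\<^sub>v grover_state N w b = grover_state N w (2 * a - b)"
proof -
  let ?a = "grover_state N w a" and ?b = "grover_state N w b"
  have dims: "dim_vec ?a = N" "dim_vec ?b = N" by (simp_all add: grover_state_def)
  have "R N (ket_bra ?a) = 2 \<cdot>\<^sub>m ket_bra ?a - 1\<^sub>m N"
    using R[unfolded reflection_access_def, rule_format, of N] ray_ket_bra[OF unit_grover_state] assms
    by simp
  also have "\<dots> *\<^sub>v ?b = (2 \<cdot>\<^sub>m ket_bra ?a) *\<^sub>v ?b - 1\<^sub>m N *\<^sub>v ?b"
    by (rule minus_mult_distrib_mat_vec[of _ N N]) (rule carrier_matI carrier_vecI; simp add: dims)+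
  also have "(2 \<cdot>\<^sub>m ket_bra ?a) *\<^sub>v ?b = 2 \<cdot>\<^sub>v (ket_bra ?a *\<^sub>v ?b)"
    by (intro eq_vecI) (auto simp: dims)
  also have "ket_bra ?a *\<^sub>v ?b = complex_of_real (cos (a - b)) \<cdot>\<^sub>v ?a"
    using assms cos_minus[of "a - b"] by (simp add: ket_bra_mult_vec dims grover_state_cscalar_prod)
  also have "1\<^sub>m N *\<^sub>v ?b = ?b" by (simp add: dims carrier_vecI)
  also have "2 \<cdot>\<^sub>v (complex_of_real (cos (a - b)) \<cdot>\<^sub>v ?a) - ?b = grover_state N w (2 * a - b)"
  \<comment> \<open>Expanding around \<open>a\<close> with 2 * a - b = a + (a - b) and b = a - (a -
    b), the terms in sin (a - b) cancel in the sum of the two vectors.\<close>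
  proof -
    have double: "2 * a - b = a + (a - b)" by simp
    have "sin (2 * a - b) = sin a * cos (a - b) + cos a * sin (a - b)"
      "cos (2 * a - b) = cos a * cos (a - b) - sin a * sin (a - b)"
      unfolding double by (rule sin_add, rule cos_add)
    moreover have "sin b = sin a * cos (a - b) - cos a * sin (a - b)"
      "cos b = cos a * cos (a - b) + sin a * sin (a - b)"
      using sin_diff[of a "a - b"] cos_diff[of a "a - b"] by simp_all
    ultimately have trig: "sin (2 * a - b) = 2 * (cos (a - b) * sin a) - sin b"
      "cos (2 * a - b) = 2 * (cos (a - b) * cos a) - cos b"
      by (simp_all add: algebra_simps)
    show ?thesis
      by (rule eq_vecI)
        (auto simp: grover_state_def trig diff_divide_distrib)
  qed
  finally show ?thesis .
qed

text \<open>Within a round the oracle acts first and the reflection is about the state before it, so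
  the angle goes from \<open>a\<close> to \<open>- a\<close> to \<open>2 * a - (- a)\<close>. The
  gate list is independent of \<open>w\<close>.\<close>

lemma run_search_grover_state:
  assumes "reflection_access R" "w < N" "N \<ge> 2"
  shows "run_search R N w (replicate k [Oracle, Reflect]) (grover_state N w \<theta>) =
    grover_state N w (3 ^ k * \<theta>)"
proof -
  have "run_round R N w [Oracle, Reflect] (grover_state N w a) = grover_state N w (3 * a)" for a
    using assms by (simp add: run_round_def grover_state_oracle grover_state_reflect)
  then have "fold (run_round R N w) (replicate k [Oracle, Reflect]) (grover_state N w \<theta>) =
      grover_state N w (3 ^ k * \<theta>)" for \<theta>
    by (induction k arbitrary: \<theta>) (simp_all add: mult_ac)
  then show ?thesis by (simp add: run_search_def)
qed

lemma oracle_calls_replicate: "oracle_calls (replicate k [Oracle, Reflect]) = k"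
  unfolding oracle_calls_def by (induction k) simp_all

section \<open>Counting the triplings\<close>

text \<open>Stop at the first tripling that reaches \<pi> / 4. The preceding angle was below \<pi> /
  4, so the last one is at most 3 * \<pi> / 4 and cannot overshoot the window where the squared sine
  is at least 1/2. The initial angle is at least \<open>1 / sqrt (real N)\<close>, so
  logarithmically many steps suffice.\<close>

lemma tripling_angle:
  assumes "N \<ge> 2"
  obtains k where "(sin (3 ^ k * arcsin (1 / sqrt (real N))))\<^sup>2 \<ge> 1 / 2"
    and "real k \<le> 1 + ln (real N)"
proof -
  define \<theta> where "\<theta> = arcsin (1 / sqrt (real N))"
  have N: "1 / sqrt (real N) \<le> 1 / sqrt 2" using assms by (intro divide_left_mono) auto
  have le1: "1 / sqrt (real N) \<le> 1" using assms by simp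
  have sin: "sin \<theta> = 1 / sqrt (real N)"
    unfolding \<theta>_def using le1 by (intro sin_arcsin) (auto intro: order_trans[of _ 0])
  \<comment> \<open>This uses N \<ge> 2 and settles the case \<open>k = 0\<close>, where no
    preceding angle bounds the final one.\<close>
  have "\<theta> \<le> arcsin (sin (pi / 4))"
    unfolding \<theta>_def sin_45 proof (rule arcsin_le_arcsin)
    show "1 / sqrt (real N) \<le> sqrt 2 / 2" 
    proof -
      have "1 / sqrt 2 = sqrt 2 / (2::real)" by (subst frac_eq_eq) simp_all
      then show ?thesis using N by linarith
    qed
    show "sqrt 2 / 2 \<le> (1::real)" using real_le_lsqrt[of 2 2] by simp
  qed (auto intro: order_trans[of _ 0])
  then have \<theta>_le: "\<theta> \<le> pi / 4" by (simp add: arcsin_sin)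
  have \<theta>_ge: "1 / sqrt (real N) \<le> \<theta>"
  proof -
    have "\<theta> \<ge> 0" unfolding \<theta>_def using le1 by (intro arcsin_nonneg) auto
    then show ?thesis using sin_x_le_x[of \<theta>] sin by simp
  qed
  have pos: "\<theta> > 0"
  proof -
    have "0 < 1 / sqrt (real N)" using assms by simp
    then show ?thesis using \<theta>_ge by linarith
  qed
  obtain m where "(pi / 4) / \<theta> < 3 ^ m" using real_arch_pow[of 3] by auto
  then have ex: "pi / 4 \<le> 3 ^ m * \<theta>" using pos by (simp add: field_simps)
  define k where "k = (LEAST k. pi / 4 \<le> 3 ^ k * \<theta>)"
  have k: "pi / 4 \<le> 3 ^ k * \<theta>" unfolding k_def using ex by (rule LeastI)
  have bounds: "3 ^ k * \<theta> \<le> 3 * pi / 4 \<and> real k \<le> 1 + ln (real N)"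
  proof (cases k)
    case 0
    have "pi / 4 \<le> 3 * pi / 4" by simp
    then have "\<theta> \<le> 3 * pi / 4" using \<theta>_le by linarith
    then show ?thesis using 0 assms by simp
  next
    case (Suc j)
    have "j < k" using Suc by simp
    then have "\<not> pi / 4 \<le> 3 ^ j * \<theta>" unfolding k_def by (rule not_less_Least)
    then have j: "3 ^ j * \<theta> < pi / 4" by simp
    have "3 ^ j * (1 / sqrt (real N)) \<le> 3 ^ j * \<theta>" using \<theta>_ge by (intro mult_left_mono) auto
    also have "\<dots> < 1" using j pi_less_4 by simp
    finally have "3 ^ j < sqrt (real N)" using assms by (simp add: field_simps)
    also have "\<dots> \<le> real N" using assms by (intro real_le_lsqrt) (auto simp: power2_eq_square)
    finally have "ln (3 ^ j) < ln (real N)" using assms by (subst ln_less_cancel_iff) auto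
    \<comment> \<open>Since e \<le> 3, ln 3 is at least 1, so \<open>ln (3 ^ j)\<close> dominates
      \<open>real j\<close>.\<close>
    moreover have "real j * 1 \<le> real j * ln 3"
      using exp_le by (intro mult_left_mono) (auto simp: ln_ge_iff)
    ultimately have "real j < ln (real N)" by (simp add: ln_realpow)
    moreover have "3 ^ k * \<theta> = 3 * (3 ^ j * \<theta>)" using Suc by simp
    ultimately show ?thesis using j Suc by (intro conjI) linarith+
  qed
  have "(sin (3 ^ k * \<theta>))\<^sup>2 \<ge> 1 / 2"
  proof -
    \<comment> \<open>The doubled angle lies between \<pi> / 2 and 3 * \<pi> / 2, where the cosine
      is nonpositive; the double-angle formula then bounds the squared sine.\<close>
    have "cos (2 * (3 ^ k * \<theta>)) \<le> 0"
    proof -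
      have "cos (2 * (3 ^ k * \<theta>)) = - sin (2 * (3 ^ k * \<theta>) - pi / 2)"
        by (simp add: sin_diff)
      moreover have "sin (2 * (3 ^ k * \<theta>) - pi / 2) \<ge> 0"
        using k bounds by (intro sin_ge_zero) auto
      ultimately show ?thesis by simp
    qed
    then show ?thesis unfolding cos_double_sin by simp
  qed
  then show thesis using that bounds unfolding \<theta>_def by blast
qed

lemma search_with_reflections:
  fixes R :: "nat \<Rightarrow> complex mat \<Rightarrow> complex mat"
  assumes R: "reflection_access R" and n: "n \<ge> 1"
  shows "\<exists>s rounds. unit_state (2 ^ n) s \<and>
    real (oracle_calls rounds) \<le> (1 + 1 / ln 2) * ln (real (2 ^ n)) \<and>
    (\<forall>w<2 ^ n. (cmod (run_search R (2 ^ n) w rounds s $ w))\<^sup>2 \<ge> 1 / 2)"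
proof -
  define N :: nat where "N = 2 ^ n"
  define \<theta> where "\<theta> = arcsin (1 / sqrt (real N))"
  have N: "N \<ge> 2" unfolding N_def using power_increasing[OF n, of "2::nat"] by simp
  obtain k where k: "(sin (3 ^ k * \<theta>))\<^sup>2 \<ge> 1 / 2" "real k \<le> 1 + ln (real N)"
    using tripling_angle[OF N] unfolding \<theta>_def by blast
  define s where "s = vec N (\<lambda>_. complex_of_real (1 / sqrt (real N)))"
  \<comment> \<open>For this \<theta> the two amplitudes in \<open>grover_state\<close> agree, so
    the start is the uniform superposition for every marked item at once.\<close>
  have s: "grover_state N w \<theta> = s" for w
  proof -
    have "1 / sqrt (real N) \<le> 1" using N by simp
    then have "sin \<theta> = 1 / sqrt (real N)" "cos \<theta> = sqrt (1 - (1 / sqrt (real N))\<^sup>2)"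
      unfolding \<theta>_def by (auto intro!: sin_arcsin cos_arcsin intro: order_trans[of _ 0])
    moreover have "sqrt (1 - (1 / sqrt (real N))\<^sup>2) / sqrt (real N - 1) = 1 / sqrt (real N)"
      using N by (simp add: power_divide field_simps flip: real_sqrt_divide real_sqrt_mult)
    ultimately show ?thesis by (intro eq_vecI) (auto simp: grover_state_def s_def)
  qed
  \<comment> \<open>As N \<ge> 2, the additive 1 is at most ln N / ln 2, which gives the constant
    \<open>1 + 1 / ln 2\<close>.\<close>
  have "ln 2 \<le> ln (real N)" using N by simp
  then have "1 + ln (real N) \<le> (1 + 1 / ln 2) * ln (real N)" by (simp add: field_simps)
  then have "real (oracle_calls (replicate k [Oracle, Reflect])) \<le> (1 + 1 / ln 2) * ln (real N)"
    using k(2) by (simp add: oracle_calls_replicate)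
  moreover have "unit_state N s"
    using unit_grover_state[of 0 N \<theta>] N by (simp add: s)
  moreover have "(cmod (run_search R N w (replicate k [Oracle, Reflect]) s $ w))\<^sup>2 \<ge> 1 / 2"
    if w: "w < N" for w
  proof -
    have "run_search R N w (replicate k [Oracle, Reflect]) s $ w = complex_of_real (sin (3 ^ k * \<theta>))"
      unfolding s[of w, symmetric] run_search_grover_state[OF R w N]
      using w by (simp add: grover_state_def)
    then show ?thesis using k(1) by (simp only: norm_of_real power2_abs)
  qed
  ultimately show ?thesis unfolding N_def by blast
qed

theorem theorem3:
  fixes T :: phase_theory
  assumes "strong_phase_access T"
  shows
    "(\<exists>(d::nat) (m::nat) (\<psi>::nat \<Rightarrow> complex vec) (q::bool protocol).
      d > 0 \<and> (\<forall>j<m. unit_state d (\<psi> j)) \<and>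
      inj_on (\<lambda>j. ket_bra (\<psi> j)) {..<m} \<and>
      module.lin_dep class_ring (module_vec TYPE(complex) d) (\<psi> ` {..<m}) \<and>
      well_formed d q \<and> uses q = 1 \<and> (\<forall>j<m. clones T q (\<psi> j)))
    \<and>
    (\<exists>(dA::nat) (dB::nat) (\<Omega>::complex vec) (meas::bool \<Rightarrow> complex vec list) (q::nat protocol).
      dA > 0 \<and> dB > 0 \<and> unit_state (dA * dB) \<Omega> \<and>
      (\<forall>b. rank_one_measurement dA (meas b)) \<and>
      well_formed dB q \<and> uses q \<ge> 1 \<and>
      (\<forall>b. steered_admissible T dB \<Omega> (meas b) q) \<and>
      steered_distribution T dB \<Omega> (meas False) q \<noteq> steered_distribution T dB \<Omega> (meas True) q)
    \<and>
    (\<exists>C>0. \<exists>c>0. \<forall>R. reflection_access R \<longrightarrow>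
      (\<forall>n\<ge>1. \<exists>s rounds. unit_state (2 ^ n) s \<and>
        real (oracle_calls rounds) \<le> C * ln (real (2 ^ n)) \<and>
        (\<forall>w<2 ^ n. (cmod (run_search R (2 ^ n) w rounds s $ w))\<^sup>2 \<ge> c)))"
proof (intro conjI)
  show "\<exists>C>0. \<exists>c>0. \<forall>R. reflection_access R \<longrightarrow>
      (\<forall>n\<ge>1. \<exists>s rounds. unit_state (2 ^ n) s \<and>
        real (oracle_calls rounds) \<le> C * ln (real (2 ^ n)) \<and>
        (\<forall>w<2 ^ n. (cmod (run_search R (2 ^ n) w rounds s $ w))\<^sup>2 \<ge> c))"
  proof (rule exI[of _ "1 + 1 / ln 2"], rule conjI, goal_cases)
    case 1
    show ?case by (simp add: add_pos_pos)
  next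
    case 2
    show ?case using search_with_reflections by (intro exI[of _ "1 / 2"]) auto
  qed
qed (fact cloning_and_signaling[OF assms])+

end
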